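(* Let $q$ be a prime power such that $q\equiv1\pmod 4$. Let $S_0$ be the set of finite places of $\mathbb{F}_q(T)$ of even degree. There is no Drinfeld singular modulus $j$ associated with a quadratic order of prime discriminant $D\in\mathbb{F}_q[T]$ of odd degree such that $j$ is also an $S_0$-unit.
   Context: Let $A=\mathbb{F}_q[T]$, $k=\mathbb{F}_q(T)$, $k_\infty=\mathbb{F}_q((1/T))$, and let $\mathbb{C}_\infty$ be the completion of an algebraic closure of $k_\infty$. Let $\mathbb{C}_\infty\{\tau\}$ be the ring of twisted polynomials, with $\tau c=c^q\tau$ for $c\in\mathbb{C}_\infty$. A Drinfeld $A$-module $\Phi$ of rank $2$ over $\mathbb{C}_\infty$ is given by $\Phi_T=T+g\tau+\Delta\tau^2\in\mathbb{C}_\infty\{\tau\}$ with $\Delta\neq0$. Its endomorphism ring is $\mathrm{End}_{\mathbb{C}_\infty}(\Phi)=\{u\in\mathbb{C}_\infty\{\tau\}\mid u\Phi_T=\Phi_Tu\}$, which is identified with a subring of $\mathbb{C}_\infty$ by taking constant coefficients (this subring contains $A$). Its $j$-invariant is $j(\Phi)=g^{q+1}/\Delta$. $\Phi$ has complex multiplication (CM) if $\mathrm{End}_{\mathbb{C}_\infty}(\Phi)\neq A$; in that case this ring is an $A$-order in an imaginary quadratic extension of $k$, i.e. a quadratic extension in which the place $\infty=1/T$ does not split. A Drinfeld singular modulus is an element of $\mathbb{C}_\infty$ of the form $j(\Phi)$ with $\Phi$ a rank $2$ Drinfeld module with CM; it is associated with the order $\mathrm{End}_{\mathbb{C}_\infty}(\Phi)$.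 Drinfeld singular moduli are integral over $A$. For $q$ odd, every order in an imaginary quadratic extension of $k$ has the form $A[\sqrt D]=A+A\sqrt D$ with $D\in A$ not a square in $k$, and $A[\sqrt D]$ is called the order of discriminant $D$. The discriminant is prime if $D$ is an irreducible polynomial. A finite place of $k$ is a nonzero prime ideal of $A$; its degree is the degree in $T$ of its monic generator. A finite prime of the finite extension $k(j)$ is a nonzero prime ideal of the integral closure of $A$ in $k(j)$. For a set $S$ of finite places of $k$, a Drinfeld singular modulus $j$ is an $S$-unit if $j\neq0$ and every finite prime of $k(j)$ dividing $j$ lies above a place in $S$. *)

theory Defs
  imports
    "HOL-Algebra.Generated_Fields"
    "HOL-Algebra.Algebraic_Closure_Type"
    "HOL-Analysis.Abstract_Metric_Spaces"
begin

text \<open>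
  The finite field with q elements is a type \<open>'a\<close> of sort \<open>{field, finite}\<close>, and
  q is \<open>CARD('a)\<close>. The ring A is \<open>'a poly\<close>, with T the polynomial variable. The completion of
  its fraction field at the infinite place is \<open>'a fls\<close>, whose variable \<open>fls_X\<close> plays the role
  of 1/T, so that T is \<open>fls_X_inv\<close>.

  A completion of the algebraic closure \<open>'a fls alg_closure\<close> is a field \<open>'c\<close> with an absolute
  value \<open>v\<close> for which \<open>'c\<close> is complete, together with an embedding \<open>e\<close> of the algebraic closure
  with dense image, such that \<open>v\<close> extends the absolute value of \<open>'a fls\<close>. As that absolute value
  extends uniquely to the algebraic closure, these data are unique up to isomorphism.
\<close>

locale completed_alg_closure =
  fixes e :: "'a :: {field, finite} fls alg_closure \<Rightarrow> 'c :: field"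
    and v :: "'c \<Rightarrow> real"
  assumes e_one: "e 1 = 1"
    and e_add: "e (x + y) = e x + e y"
    and e_mult: "e (x * y) = e x * e y"
    and v_nonneg: "0 \<le> v z"
    and v_eq_0_iff: "v z = 0 \<longleftrightarrow> z = 0"
    and v_mult: "v (z * w) = v z * v w"
    and v_ultrametric: "v (z + w) \<le> max (v z) (v w)"
    and v_extends: "f \<noteq> 0 \<Longrightarrow> v (e (to_ac f)) = real CARD('a) powi (- fls_subdegree f)"
    and complete: "Metric_space.mcomplete UNIV (\<lambda>z w. v (z - w))"
    and dense: "\<epsilon> > 0 \<Longrightarrow> \<exists>x. v (z - e x) < \<epsilon>"

definition A_embed :: "('a :: {field, finite} fls alg_closure \<Rightarrow> 'c :: field) \<Rightarrow> 'a poly \<Rightarrow> 'c" where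
  "A_embed e a = e (to_ac (poly (map_poly fls_const a) fls_X_inv))"

text \<open>
  The twisted polynomial \<open>\<Sum>i. u\<^sub>i \<tau>^i\<close> is represented by the element of \<open>'c poly\<close> with the same
  coefficients. Addition is that of \<open>'c poly\<close>, but multiplication is the one determined by
  \<open>\<tau> c = c^q \<tau>\<close>.
\<close>

definition twisted_mult :: "nat \<Rightarrow> 'c :: field poly \<Rightarrow> 'c poly \<Rightarrow> 'c poly" where
  "twisted_mult q u w =
     (\<Sum>i\<le>degree u. \<Sum>j\<le>degree w. monom (coeff u i * coeff w j ^ (q ^ i)) (i + j))"

lemma twisted_mult_tau: "twisted_mult q (monom 1 1) [:c:] = twisted_mult q [:c ^ q:] (monom 1 1)"
  by (simp add: twisted_mult_def degree_monom_eq)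

text \<open>
  Below, \<open>\<iota>\<close> is the inclusion of A into \<open>'c\<close>. A Drinfeld module of rank 2 is given by
  coefficients \<open>g\<close> and \<open>\<Delta> \<noteq> 0\<close>.
\<close>

definition drinfeld_T :: "('a :: {field, finite} poly \<Rightarrow> 'c :: field) \<Rightarrow> 'c \<Rightarrow> 'c \<Rightarrow> 'c poly" where
  "drinfeld_T \<iota> g \<Delta> = [:\<iota> [:0, 1:], g, \<Delta>:]"

definition drinfeld_End :: "('a :: {field, finite} poly \<Rightarrow> 'c :: field) \<Rightarrow> 'c \<Rightarrow> 'c \<Rightarrow> 'c poly set" where
  "drinfeld_End \<iota> g \<Delta> =
     {u. twisted_mult CARD('a) u (drinfeld_T \<iota> g \<Delta>) = twisted_mult CARD('a) (drinfeld_T \<iota> g \<Delta>) u}"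

definition End_ring :: "('a :: {field, finite} poly \<Rightarrow> 'c :: field) \<Rightarrow> 'c \<Rightarrow> 'c \<Rightarrow> 'c set" where
  "End_ring \<iota> g \<Delta> = (\<lambda>u. coeff u 0) ` drinfeld_End \<iota> g \<Delta>"

definition has_CM :: "('a :: {field, finite} poly \<Rightarrow> 'c :: field) \<Rightarrow> 'c \<Rightarrow> 'c \<Rightarrow> bool" where
  "has_CM \<iota> g \<Delta> \<longleftrightarrow> End_ring \<iota> g \<Delta> \<noteq> range \<iota>"

definition j_invariant :: "nat \<Rightarrow> 'c :: field \<Rightarrow> 'c \<Rightarrow> 'c" where
  "j_invariant q g \<Delta> = g ^ (q + 1) / \<Delta>"

definition singular_modulus_of_order ::
    "('a :: {field, finite} poly \<Rightarrow> 'c :: field) \<Rightarrow> 'c set \<Rightarrow> 'c \<Rightarrow> bool" where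
  "singular_modulus_of_order \<iota> R j \<longleftrightarrow>
     (\<exists>g \<Delta>. \<Delta> \<noteq> 0 \<and> has_CM \<iota> g \<Delta> \<and> End_ring \<iota> g \<Delta> = R \<and> j_invariant CARD('a) g \<Delta> = j)"

text \<open>The choice of the square root \<open>s\<close> of \<open>D\<close> does not affect \<open>R\<close>.\<close>

definition order_of_discriminant ::
    "('a :: {field, finite} poly \<Rightarrow> 'c :: field) \<Rightarrow> 'a poly \<Rightarrow> 'c set \<Rightarrow> bool" where
  "order_of_discriminant \<iota> D R \<longleftrightarrow>
     (\<nexists>x :: 'a poly fract. x ^ 2 = to_fract D) \<and>
     (\<exists>s. s ^ 2 = \<iota> D \<and> R = {\<iota> a + \<iota> b * s | a b. True})"

text \<open>A field containing A contains its fraction field k, so this is k(j).\<close>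

definition k_adjoin :: "('a :: {field, finite} poly \<Rightarrow> 'c :: field) \<Rightarrow> 'c \<Rightarrow> 'c set" where
  "k_adjoin \<iota> j = generate_field ring_of_type_algebra (range \<iota> \<union> {j})"

definition integral_closure_in ::
    "('a :: {field, finite} poly \<Rightarrow> 'c :: field) \<Rightarrow> 'c set \<Rightarrow> 'c set" where
  "integral_closure_in \<iota> L =
     {x \<in> L. \<exists>p :: 'a poly poly. lead_coeff p = 1 \<and> poly (map_poly \<iota> p) x = 0}"

definition finite_prime ::
    "('a :: {field, finite} poly \<Rightarrow> 'c :: field) \<Rightarrow> 'c set \<Rightarrow> 'c set \<Rightarrow> bool" where
  "finite_prime \<iota> L P \<longleftrightarrow>
     primeideal P (ring_of_type_algebra\<lparr>carrier := integral_closure_in \<iota> L\<rparr>) \<and> P \<noteq> {0}"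

definition finite_place :: "'a :: {field, finite} poly set \<Rightarrow> bool" where
  "finite_place p \<longleftrightarrow> primeideal p ring_of_type_algebra \<and> p \<noteq> {0}"

definition place_degree :: "'a :: {field, finite} poly set \<Rightarrow> nat" where
  "place_degree p =
     degree (THE f :: 'a poly. lead_coeff f = 1 \<and> p = PIdl\<^bsub>ring_of_type_algebra\<^esub> f)"

definition even_places :: "'a :: {field, finite} poly set set" where
  "even_places = {p. finite_place p \<and> even (place_degree p)}"

text \<open>
  The following is meant for \<open>j\<close> integral over A, as all singular moduli are. For such \<open>j\<close>,
  a prime \<open>P\<close> divides \<open>j\<close> if and only if \<open>j \<in> P\<close>. The place below \<open>P\<close> is the contraction of
  \<open>P\<close> to A.
\<close>

definition S_unit ::
    "('a :: {field, finite} poly \<Rightarrow> 'c :: field) \<Rightarrow> 'a poly set set \<Rightarrow> 'c \<Rightarrow> bool" where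
  "S_unit \<iota> S j \<longleftrightarrow>
     j \<noteq> 0 \<and> (\<forall>P. finite_prime \<iota> (k_adjoin \<iota> j) P \<and> j \<in> P \<longrightarrow> \<iota> -` P \<in> S)"

end

theory Submission
  imports Defs
begin

text \<open>
  Let \<open>\<Phi>\<^sub>T = T + g \<tau> + \<Delta> \<tau>\<^sup>2\<close> have complex multiplication by \<open>A[\<surd>D]\<close> with \<open>D\<close> of odd degree, and let its
  invariant \<open>j\<close> be nonzero. The endomorphism \<open>u\<close> with constant term \<open>\<surd>D\<close> satisfies \<open>u\<^sup>2 = \<Phi>\<^sub>D\<close>, hence its
  degree in \<open>\<tau>\<close> is \<open>deg D\<close>, an odd number. Everything follows from this parity: it will be shown that
  \<open>j\<close> is integral and that some prime divides \<open>j\<close>, but no prime above a place of even degree does.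
  Scaling makes \<open>g = 1\<close> and \<open>\<Delta> = y = 1/j\<close>.
  
  Integrality (\<open>potential_good_reduction\<close>): at a finite place with \<open>|y| < 1\<close> the module reduces to \<open>T + \<tau>\<close>,
  of rank one, and \<open>u\<^sup>2 = \<Phi>\<^sub>D\<close> to a twisted polynomial of degree \<open>deg D\<close>; but a square has even degree.
  
  The infinite place (\<open>abs_inverse_j_less_1\<close>): if \<open>|y| \<ge> 1\<close>, the Newton polygon of \<open>\<Phi>\<^sub>T\<close> skips the middle
  term, and commuting with \<open>\<Phi>\<^sub>T\<close> then forces all slopes of the Newton polygon of \<open>u\<close> to be even powers of
  \<open>q\<close>. So \<open>|y| < 1\<close>. The coefficients of \<open>u\<close> are \<open>\<surd>D\<close> times polynomials in \<open>y\<close> over the field \<open>k\<close> of fractions of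
  \<open>A\<close>, so the same is true of all conjugates of \<open>y\<close> over \<open>k\<close>. The norm of \<open>y\<close> is a nonzero element of
  \<open>k\<close> of absolute value less than 1, therefore \<open>y\<close> is not integral (\<open>inverse_j_not_integral\<close>), that is, some
  finite prime divides \<open>j\<close>.
  
  Places of even degree (\<open>even_degree_of_reduction_to_j_0\<close>): at a prime dividing \<open>j\<close> the module has good
  reduction \<open>T + \<tau>\<^sup>2\<close>. If the place below has even degree, then \<open>T^(q^n) - T\<close> does not vanish there for odd
  \<open>n\<close>, and a twisted polynomial that commutes with \<open>T + \<tau>\<^sup>2\<close> contains only even powers of \<open>\<tau>\<close>. The
  reduction of \<open>u\<close> has odd degree, a contradiction.
  
  Places are represented by valuation rings. The theorem \<open>exists_valuation_ring_avoiding\<close> supplies a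
  valuation ring for every element that is not integral, which turns the above into statements on
  integral closures and their primes.
\<close>

section \<open>Integral elements and valuation rings\<close>

locale unital_subring =
  fixes S :: "'c :: field set"
  assumes one_mem: "1 \<in> S"
    and diff_mem: "x \<in> S \<Longrightarrow> y \<in> S \<Longrightarrow> x - y \<in> S"
    and mult_mem: "x \<in> S \<Longrightarrow> y \<in> S \<Longrightarrow> x * y \<in> S"
begin

lemma zero_mem: "0 \<in> S"
  using diff_mem[OF one_mem one_mem] by simp

lemma uminus_mem: "x \<in> S \<Longrightarrow> - x \<in> S"
  using diff_mem[OF zero_mem] by simp

lemma add_mem: "x \<in> S \<Longrightarrow> y \<in> S \<Longrightarrow> x + y \<in> S"
  using diff_mem[OF _ uminus_mem] by fastforce

lemma power_mem: "x \<in> S \<Longrightarrow> x ^ n \<in> S"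
  by (induction n) (auto intro: one_mem mult_mem)

lemma sum_mem: "(\<And>i. i \<in> I \<Longrightarrow> f i \<in> S) \<Longrightarrow> sum f I \<in> S"
  by (induction I rule: infinite_finite_induct) (auto intro: zero_mem add_mem)

lemma prod_mset_mem: "(\<And>r. r \<in># A \<Longrightarrow> r \<in> S) \<Longrightarrow> prod_mset A \<in> S"
  by (induction A) (auto intro: one_mem mult_mem)

lemma poly_mem: "(\<And>i. coeff p i \<in> S) \<Longrightarrow> z \<in> S \<Longrightarrow> poly p z \<in> S"
  unfolding poly_altdef by (auto intro!: sum_mem mult_mem power_mem)

lemma coeff_mult_mem:
  "(\<And>i. coeff p i \<in> S) \<Longrightarrow> (\<And>i. coeff r i \<in> S) \<Longrightarrow> coeff (p * r) i \<in> S"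
  by (auto simp: coeff_mult intro!: sum_mem mult_mem)

end

definition adjoin :: "'c :: field set \<Rightarrow> 'c \<Rightarrow> 'c set" where
  "adjoin S z = {poly p z | p. \<forall>i. coeff p i \<in> S}"

definition integral_over :: "'c :: field set \<Rightarrow> 'c \<Rightarrow> bool" where
  "integral_over S x \<longleftrightarrow> (\<exists>p. lead_coeff p = 1 \<and> (\<forall>i. coeff p i \<in> S) \<and> poly p x = 0)"

context unital_subring
begin

lemma subset_adjoin: "S \<subseteq> adjoin S z"
proof
  fix c assume "c \<in> S"
  then have "\<forall>i. coeff [:c:] i \<in> S" by (auto simp: coeff_pCons zero_mem split: nat.split)
  then show "c \<in> adjoin S z" unfolding adjoin_def
    by (auto intro!: exI[of _ "[:c:]"])
qed

lemma generator_mem_adjoin: "z \<in> adjoin S z"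
  unfolding adjoin_def
  by (auto intro!: exI[of _ "[:0, 1:]"] simp: coeff_pCons zero_mem one_mem split: nat.split)

lemma unital_subring_adjoin: "unital_subring (adjoin S z)"
proof
  show "1 \<in> adjoin S z" using subset_adjoin one_mem by blast
next
  fix x y assume "x \<in> adjoin S z" "y \<in> adjoin S z"
  then obtain p r where p: "x = poly p z" "\<forall>i. coeff p i \<in> S"
    and r: "y = poly r z" "\<forall>i. coeff r i \<in> S" unfolding adjoin_def by auto
  show "x - y \<in> adjoin S z" unfolding adjoin_def
    using p r by (auto intro!: exI[of _ "p - r"] diff_mem)
  show "x * y \<in> adjoin S z" unfolding adjoin_def
    using p r by (auto intro!: exI[of _ "p * r"] coeff_mult_mem)
qed

lemma reflect_poly_mem: "(\<And>i. coeff p i \<in> S) \<Longrightarrow> coeff (reflect_poly p) i \<in> S"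
  by (simp add: coeff_reflect_poly zero_mem)

lemma integral_if_mem_adjoin_inverse:
  assumes "x \<noteq> 0" and "x \<in> adjoin S (inverse x)"
  shows "integral_over S x"
proof -
  obtain p where p: "x = poly p (inverse x)" "\<And>i. coeff p i \<in> S"
    using assms(2) unfolding adjoin_def by auto
  define n where "n = degree p"
  define r where "r = monom 1 (Suc n) - reflect_poly p"
  have lt: "degree (reflect_poly p) < Suc n"
    unfolding n_def by (rule le_imp_less_Suc) (rule degree_reflect_poly_le)
  have c: "coeff r (Suc n) = 1"
    using lt by (simp add: r_def coeff_eq_0)
  have "degree r = Suc n"
  proof (rule antisym)
    show "degree r \<le> Suc n" unfolding r_def
      by (rule degree_diff_le) (use lt in \<open>auto simp: degree_monom_eq\<close>)
    show "Suc n \<le> degree r" by (rule le_degree) (simp add: c)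
  qed
  then have "lead_coeff r = 1" using c by simp
  moreover have "coeff r i \<in> S" for i
    unfolding r_def coeff_diff
    by (rule diff_mem) (auto simp: one_mem zero_mem intro: reflect_poly_mem p)
  moreover have "poly r x = 0"
    using poly_reflect_poly_nz[OF assms(1), of p] p(1)
    by (simp add: r_def poly_monom n_def)
  ultimately show ?thesis unfolding integral_over_def by blast
qed

end

locale valuation_ring = unital_subring R for R :: "'c :: field set" +
  assumes total_mem: "x \<in> R \<or> inverse x \<in> R"

text \<open>
  Chevalley's extension theorem, in the form "a non-integral \<open>x\<close> has a pole somewhere". Among the
  subrings that contain \<open>S\<close> and \<open>y = 1/x\<close> but not \<open>x\<close>, a maximal one is a valuation ring:
  maximality makes \<open>y\<close> an element of the Jacobson radical, and if neither \<open>z\<close> nor \<open>1/z\<close> belonged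
  to the ring then \<open>1\<close> would be a polynomial both in \<open>z\<close> and in \<open>1/z\<close> with coefficients in the ideal
  generated by \<open>y\<close>; two such relations of minimal degree shorten each other.
\<close>

theorem exists_valuation_ring_avoiding:
  fixes S :: "'c :: field set"
  assumes "unital_subring S" and nint: "\<not> integral_over S x"
  obtains R where "valuation_ring R" "S \<subseteq> R" "x \<notin> R"
proof -
  interpret S: unital_subring S by fact
  have x0: "x \<noteq> 0"
  proof
    assume "x = 0"
    then have "integral_over S x" unfolding integral_over_def
      by (intro exI[of _ "[:0, 1:]"]) (auto simp: coeff_pCons S.zero_mem S.one_mem split: nat.split)
    then show False using nint by simp
  qed
  define y where "y = inverse x"
  have xy: "x * y = 1" using x0 by (simp add: y_def)
  define F where "F = {R. unital_subring R \<and> S \<subseteq> R \<and> y \<in> R \<and> x \<notin> R}"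
  have "adjoin S y \<in> F"
    using S.unital_subring_adjoin S.subset_adjoin S.generator_mem_adjoin
      S.integral_if_mem_adjoin_inverse[OF x0] nint unfolding F_def y_def by blast
  moreover have "\<Union>C \<in> F" if C: "C \<noteq> {}" "subset.chain F C" for C
  proof -
    have sub: "R \<in> F" if "R \<in> C" for R using C that by (auto simp: subset.chain_def)
    have dir: "\<exists>R\<in>C. a \<in> R \<and> b \<in> R" if ab: "a \<in> \<Union>C" "b \<in> \<Union>C" for a b
    proof -
      obtain A B where "A \<in> C" "B \<in> C" "a \<in> A" "b \<in> B" using ab by auto
      moreover have "A \<subseteq> B \<or> B \<subseteq> A"
        using C(2) \<open>A \<in> C\<close> \<open>B \<in> C\<close> by (auto simp: subset.chain_def)
      ultimately show ?thesis by auto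
    qed
    have "unital_subring (\<Union>C)"
    proof
      show "1 \<in> \<Union>C" using C(1) sub unfolding F_def unital_subring_def by blast
    next
      fix a b assume "a \<in> \<Union>C" "b \<in> \<Union>C"
      then obtain R where R: "R \<in> C" "a \<in> R" "b \<in> R" using dir by blast
      then interpret R: unital_subring R using sub F_def by blast
      show "a - b \<in> \<Union>C" "a * b \<in> \<Union>C" using R R.diff_mem R.mult_mem by blast+
    qed
    then show ?thesis using C(1) sub unfolding F_def by blast
  qed
  ultimately obtain R where RF: "R \<in> F" and max: "\<And>R'. R' \<in> F \<Longrightarrow> R \<subseteq> R' \<Longrightarrow> R' = R"
    using subset_Zorn_nonempty[of F] by blast
  interpret R: unital_subring R using RF F_def by blast
  have R: "S \<subseteq> R" "y \<in> R" "x \<notin> R" using RF F_def by blast+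
  have adj: "x \<in> adjoin R z" if "z \<notin> R" for z
  proof (rule ccontr)
    assume "x \<notin> adjoin R z"
    then have "adjoin R z \<in> F"
      unfolding F_def using R R.subset_adjoin[of z] R.unital_subring_adjoin[of z] by auto
    then have "adjoin R z = R" using max R.subset_adjoin by blast
    then show False using R.generator_mem_adjoin that by blast
  qed
  (* y lies in the Jacobson radical of R, because x does not survive inverting 1 + y b *)
  have unit: "1 + y * b \<noteq> 0 \<and> inverse (1 + y * b) \<in> R" if b: "b \<in> R" for b
  proof -
    define u where "u = 1 + y * b"
    have uR: "u \<in> R" unfolding u_def using b R by (intro R.add_mem R.one_mem R.mult_mem)
    have u0: "u \<noteq> 0"
    proof
      assume "u = 0"
      then have "x * (1 + y * b) = 0" by (simp add: u_def)
      then have "x = - b" using xy by (simp add: algebra_simps eq_neg_iff_add_eq_0)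
      then show False using R R.uminus_mem[OF b] by simp
    qed
    have xu: "x * u ^ n - x \<in> R" for n
    proof (induction n)
      case (Suc n)
      have "x * u ^ Suc n - x = (x * u ^ n - x) + (x * y) * (b * u ^ n)"
        unfolding power_Suc by (subst (1) u_def) (simp add: algebra_simps)
      also have "\<dots> = (x * u ^ n - x) + b * u ^ n" using xy by simp
      also have "\<dots> \<in> R" by (intro R.add_mem R.mult_mem R.power_mem Suc b uR)
      finally show ?case .
    qed (simp add: R.zero_mem)
    have "inverse u \<in> R"
    proof (rule ccontr)
      assume "inverse u \<notin> R"
      from adj[OF this] obtain p where p: "x = poly p (inverse u)" "\<And>i. coeff p i \<in> R"
        unfolding adjoin_def by auto
      have "x * u ^ degree p = poly (reflect_poly p) u"
        using poly_reflect_poly_nz[OF u0, of p] p(1) by (simp add: mult.commute)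
      moreover have "poly (reflect_poly p) u \<in> R"
        by (rule R.poly_mem[OF R.reflect_poly_mem[OF p(2)] uR])
      ultimately have "x * u ^ degree p - (x * u ^ degree p - x) \<in> R"
        using xu R.diff_mem by metis
      then show False using R by simp
    qed
    then show ?thesis using u0 by (simp add: u_def)
  qed
  define I where "I = (\<lambda>r. y * r) ` R"
  have I_R: "c \<in> R" if "c \<in> I" for c using that R R.mult_mem by (auto simp: I_def)
  have I_mult: "c * r \<in> I" if "c \<in> I" "r \<in> R" for c r
    using that R.mult_mem by (auto simp: I_def mult.assoc)
  have I_diff: "c - r \<in> I" if "c \<in> I" "r \<in> I" for c r
    using that R.diff_mem by (auto simp: I_def simp flip: right_diff_distrib)
  have I0: "0 \<in> I" using R.zero_mem by (force simp: I_def)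
  have I_add: "c + r \<in> I" if "c \<in> I" "r \<in> I" for c r
    using I_diff[OF that(1) I_diff[OF I0 that(2)]] by simp
  have I_sum: "sum f A \<in> I" if "\<And>i. i \<in> A \<Longrightarrow> f i \<in> I" for f and A :: "nat set"
    using that by (induction A rule: infinite_finite_induct) (auto intro: I0 I_add)
  have I1: "1 \<notin> I"
  proof
    assume "1 \<in> I"
    then obtain r where "r \<in> R" "y * r = 1" by (auto simp: I_def)
    then have "x = r" using xy by (metis mult.left_commute mult.right_neutral)
    then show False using R \<open>r \<in> R\<close> by simp
  qed
  (* the classical descent: two relations of minimal degree shorten each other *)
  have shorten: "\<exists>a'. (\<forall>i. coeff a' i \<in> I) \<and> poly a' z = 1 \<and> degree a' < degree a"
    if a: "\<And>i. coeff a i \<in> I" "poly a z = 1"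
      and b: "\<And>i. coeff b i \<in> I" "poly b (inverse z) = 1"
      and le: "degree b \<le> degree a" and z0: "z \<noteq> 0" for a b z
  proof -
    define m n where "m = degree a" and "n = degree b"
    obtain r where r: "r \<in> R" "coeff b 0 = y * r" using b(1)[of 0] by (auto simp: I_def)
    define u where "u = 1 - coeff b 0"
    have u: "u \<noteq> 0" "inverse u \<in> R"
      using unit[of "- r"] r R.uminus_mem by (auto simp: u_def)
    have m0: "m > 0"
    proof (rule ccontr)
      assume "\<not> m > 0"
      then obtain c where "a = [:c:]" unfolding m_def using degree_eq_zeroE by blast
      then have "coeff a 0 = 1" using a(2) by simp
      then show False using a(1)[of 0] I1 by simp
    qed
    have "1 = (\<Sum>i\<le>n. coeff b i * inverse z ^ i)"
      using b(2) by (simp add: poly_altdef n_def)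
    also have "\<dots> = coeff b 0 + (\<Sum>i=1..n. coeff b i * inverse z ^ i)"
      by (simp add: atMost_atLeast0 sum.atLeast_Suc_atMost)
    finally have "u = (\<Sum>i=1..n. coeff b i * inverse z ^ i)"
      unfolding u_def by (simp add: algebra_simps)
    then have "u * z ^ m = (\<Sum>i=1..n. coeff b i * inverse z ^ i * z ^ m)"
      by (simp add: sum_distrib_right)
    also have "\<dots> = (\<Sum>i=1..n. coeff b i * z ^ (m - i))"
    proof (rule sum.cong[OF refl])
      fix i assume "i \<in> {1..n}"
      then have "i \<le> m" using le by (simp add: m_def n_def)
      then have "z ^ m = z ^ i * z ^ (m - i)" by (simp flip: power_add)
      then show "coeff b i * inverse z ^ i * z ^ m = coeff b i * z ^ (m - i)"
        using z0 by (simp add: power_inverse)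
    qed
    finally have zm: "z ^ m = inverse u * (\<Sum>i=1..n. coeff b i * z ^ (m - i))"
      using u(1) by (simp add: field_simps)
    define c where "c = (\<Sum>i=1..n. monom (coeff b i) (m - i))"
    define a' where "a' = a - monom (coeff a m) m + smult (coeff a m * inverse u) c"
    have "poly c z = u * z ^ m"
      using zm u(1) by (simp add: c_def poly_sum poly_monom)
    then have "poly a' z = 1"
      using a(2) u(1) by (simp add: a'_def poly_monom)
    moreover have "coeff a' i \<in> I" for i
    proof -
      have "coeff c i \<in> I" unfolding c_def coeff_sum
        by (rule I_sum) (auto intro: b I0)
      then have "coeff c i * (coeff a m * inverse u) \<in> I"
        using a(1)[of m] I_R u(2) R.mult_mem I_mult by blast
      then have "coeff (smult (coeff a m * inverse u) c) i \<in> I"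
        by (simp add: mult.commute)
      then show ?thesis unfolding a'_def coeff_add coeff_diff
        by (intro I_add I_diff a(1)) (auto intro: a(1) I0)
    qed
    moreover have "degree a' < m"
    proof (rule degree_lessI)
      show "a' \<noteq> 0 \<or> 0 < m" using m0 by simp
      show "\<forall>k\<ge>m. coeff a' k = 0"
      proof (intro allI impI)
        fix k assume k: "k \<ge> m"
        have "coeff c k = 0" unfolding c_def coeff_sum
          using k m0 by (intro sum.neutral) auto
        moreover have "coeff a k = 0" if "k \<noteq> m"
          using k that by (intro coeff_eq_0) (simp add: m_def)
        ultimately show "coeff a' k = 0" by (simp add: a'_def)
      qed
    qed
    ultimately show ?thesis unfolding m_def by blast
  qed
  have no_relations: False
    if "\<And>i. coeff a i \<in> I" "poly a z = 1" "\<And>i. coeff b i \<in> I" "poly b (inverse z) = 1" "z \<noteq> 0"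
    for a b z
    using that
  proof (induction "degree a + degree b" arbitrary: a b rule: less_induct)
    case less
    show False
    proof (cases "degree b \<le> degree a")
      case True
      from shorten[OF less.prems(1-4) True less.prems(5)] show False
        using less.hyps[OF _ _ _ less.prems(3-5)] by (metis add_less_cancel_right)
    next
      case False
      have "inverse z \<noteq> 0" "degree a \<le> degree b" "poly a (inverse (inverse z)) = 1"
        using less.prems False by auto
      from shorten[OF less.prems(3,4) less.prems(1) this(3,2,1)] show False
        using less.hyps[OF _ less.prems(1,2) _ _ less.prems(5)] by (metis add_less_cancel_left)
    qed
  qed
  have rel: "\<exists>a. (\<forall>i. coeff a i \<in> I) \<and> poly a z = 1" if "z \<notin> R" for z
  proof -
    from adj[OF that] obtain p where p: "x = poly p z" "\<And>i. coeff p i \<in> R"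
      unfolding adjoin_def by auto
    show ?thesis
      by (rule exI[of _ "smult y p"]) (use p xy in \<open>auto simp: I_def mult.commute\<close>)
  qed
  have "valuation_ring R"
  proof
    fix z show "z \<in> R \<or> inverse z \<in> R"
    proof (rule ccontr)
      assume n: "\<not> (z \<in> R \<or> inverse z \<in> R)"
      then have "z \<noteq> 0" using R.zero_mem by auto
      then show False using rel[of z] rel[of "inverse z"] n no_relations by blast
    qed
  qed
  then show thesis using that R by blast
qed

section \<open>Dominant coefficients of twisted polynomials\<close>

lemma coeff_twisted_mult:
  assumes "q > 0"
  shows "coeff (twisted_mult q u w) n = (\<Sum>k\<le>n. coeff u k * coeff w (n - k) ^ (q ^ k))"
proof -
  have "coeff (twisted_mult q u w) n =
    (\<Sum>i\<le>degree u. \<Sum>j\<le>degree w. if i + j = n then coeff u i * coeff w j ^ (q ^ i) else 0)"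
    by (simp add: twisted_mult_def coeff_sum)
  also have "\<dots> = (\<Sum>i\<le>degree u. if i \<le> n then coeff u i * coeff w (n - i) ^ (q ^ i) else 0)"
  proof (rule sum.cong[OF refl])
    fix i
    have "(\<Sum>j\<le>degree w. if i + j = n then coeff u i * coeff w j ^ (q ^ i) else 0) =
      (\<Sum>j\<le>degree w. if j = n - i then (if i \<le> n then coeff u i * coeff w j ^ (q ^ i) else 0) else 0)"
      by (rule sum.cong) auto
    also have "\<dots> = (if i \<le> n then coeff u i * coeff w (n - i) ^ (q ^ i) else 0)"
      using assms by (simp add: coeff_eq_0 power_0_left)
    finally show "(\<Sum>j\<le>degree w. if i + j = n then coeff u i * coeff w j ^ (q ^ i) else 0) =
      (if i \<le> n then coeff u i * coeff w (n - i) ^ (q ^ i) else 0)" .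
  qed
  also have "\<dots> = (\<Sum>i\<in>{..degree u} \<inter> {..n}. coeff u i * coeff w (n - i) ^ (q ^ i))"
    by (subst sum.inter_restrict) (auto intro!: sum.cong)
  also have "\<dots> = (\<Sum>i\<le>n. coeff u i * coeff w (n - i) ^ (q ^ i))"
    by (rule sum.mono_neutral_left) (auto simp: coeff_eq_0)
  finally show ?thesis .
qed

context valuation_ring
begin

lemma integral_mem:
  assumes "S \<subseteq> R" and "integral_over S x"
  shows "x \<in> R"
proof (rule ccontr)
  assume x: "x \<notin> R"
  then have x0: "x \<noteq> 0" and ix: "inverse x \<in> R" using zero_mem total_mem by auto
  obtain p where p: "lead_coeff p = 1" "\<And>i. coeff p i \<in> R" "poly p x = 0"
    using assms unfolding integral_over_def by blast
  obtain t where t: "reflect_poly p = pCons 1 t"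
  proof (cases "reflect_poly p")
    case (pCons c t)
    then have "c = lead_coeff p" by (metis coeff_0_reflect_poly coeff_pCons_0)
    then show ?thesis using that pCons p(1) by simp
  qed
  have "coeff t i \<in> R" for i
    using reflect_poly_mem[OF p(2), of "Suc i"] by (simp add: t)
  then have "poly t (inverse x) \<in> R" using ix by (rule poly_mem)
  moreover have "poly (reflect_poly p) (inverse x) = 0"
    using poly_reflect_poly_nz[of "inverse x" p] x0 p(3) by simp
  then have "x = - poly t (inverse x)"
    using x0 by (simp add: t field_simps eq_neg_iff_add_eq_0 add.commute)
  ultimately show False using x uminus_mem by metis
qed

text \<open>
  The divisibility preorder \<open>vle\<close> stands for the inequality between the absolute values that belong
  to \<open>R\<close>. As the value group is only implicit, radii of discs are given by elements of the field.
\<close>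

definition vle :: "'c \<Rightarrow> 'c \<Rightarrow> bool" where
  "vle x y \<longleftrightarrow> (\<exists>r\<in>R. x = r * y)"

abbreviation vlt :: "'c \<Rightarrow> 'c \<Rightarrow> bool" where
  "vlt x y \<equiv> \<not> vle y x"

lemma vle_1_iff: "vle x 1 \<longleftrightarrow> x \<in> R"
  by (auto simp: vle_def)

lemma vle_refl [simp]: "vle x x"
  unfolding vle_def using one_mem by (intro bexI[of _ 1]) auto

lemma vle_0 [simp]: "vle 0 x"
  unfolding vle_def using zero_mem by (intro bexI[of _ 0]) auto

lemma vle_0_iff [simp]: "vle x 0 \<longleftrightarrow> x = 0"
  unfolding vle_def using zero_mem by auto

lemma vle_trans: "vle x y \<Longrightarrow> vle y z \<Longrightarrow> vle x z"
  unfolding vle_def using mult_mem by (metis mult.assoc)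

lemma vle_total: "vle x y \<or> vle y x"
proof (cases "x = 0 \<or> y = 0")
  case False
  then have "x = (x / y) * y" "y = inverse (x / y) * x" by auto
  then show ?thesis using total_mem[of "x / y"] unfolding vle_def by blast
qed auto

lemma vlt_imp_vle: "vlt x y \<Longrightarrow> vle x y"
  using vle_total by blast

lemma vlt_vle_trans: "vlt x y \<Longrightarrow> vle y z \<Longrightarrow> vlt x z"
  using vle_trans by blast

lemma vle_vlt_trans: "vle x y \<Longrightarrow> vlt y z \<Longrightarrow> vlt x z"
  using vle_trans by blast

lemma vle_mult: "vle a b \<Longrightarrow> vle c d \<Longrightarrow> vle (a * c) (b * d)"
  unfolding vle_def using mult_mem by (metis mult.assoc mult.left_commute)

lemma vle_power: "vle a b \<Longrightarrow> vle (a ^ n) (b ^ n)"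
  by (induction n) (auto intro: vle_mult)

lemma vle_cancel: "c \<noteq> 0 \<Longrightarrow> vle (a * c) (b * c) \<longleftrightarrow> vle a b"
  unfolding vle_def by (auto simp flip: mult.assoc)

lemma vlt_mult:
  assumes "vlt a b" "vle c d" "d \<noteq> 0"
  shows "vlt (a * c) (b * d)"
proof
  assume "vle (b * d) (a * c)"
  also have "vle (a * c) (a * d)" using assms by (intro vle_mult vle_refl)
  finally (vle_trans) show False using assms by (simp add: vle_cancel)
qed

lemma vlt_power: "vlt a b \<Longrightarrow> n > 0 \<Longrightarrow> vlt (a ^ n) (b ^ n)"
proof (induction n)
  case (Suc n)
  then have "b \<noteq> 0" by auto
  then show ?case using Suc vlt_mult[OF Suc.prems(1), of "a ^ n" "b ^ n"]
    by (auto intro: vle_power vlt_imp_vle)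
qed simp

lemma vle_add: "vle a c \<Longrightarrow> vle b c \<Longrightarrow> vle (a + b) c"
  unfolding vle_def using add_mem by (metis distrib_right)

lemma vle_uminus: "vle (- a) c \<longleftrightarrow> vle a c"
  unfolding vle_def using uminus_mem by (metis minus_minus mult_minus_left)

lemma vle_uminus_right: "vle a (- c) \<longleftrightarrow> vle a c"
  using vle_uminus[of "- c" "- c"] vle_uminus[of c c] vle_trans vle_refl by (metis minus_minus)

lemma vlt_add:
  assumes "vlt a c" "vlt b c"
  shows "vlt (a + b) c"
proof (cases "vle a b")
  case True
  then show ?thesis using vle_add[OF True vle_refl] assms(2) vle_trans by blast
next
  case False
  then have "vle b a" using vle_total by blast
  then show ?thesis using vle_add[OF vle_refl] assms(1) vle_trans by blast
qed

lemma vle_sum: "(\<And>i. i \<in> I \<Longrightarrow> vle (f i) c) \<Longrightarrow> vle (sum f I) c"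
  by (induction I rule: infinite_finite_induct) (auto intro: vle_add)

lemma vlt_sum: "c \<noteq> 0 \<Longrightarrow> (\<And>i. i \<in> I \<Longrightarrow> vlt (f i) c) \<Longrightarrow> vlt (sum f I) c"
  by (induction I rule: infinite_finite_induct) (auto simp: vlt_add)

text \<open>
  On the disc of radius \<open>|\<rho>|\<close> the additive polynomial \<open>\<Sum>k. u\<^sub>k x^(q^k)\<close> has Gauss norm
  \<open>max |u\<^sub>k \<rho>^(q^k)|\<close>. The dominant index is the last one at which this maximum is attained; the power
  of \<open>q\<close> with it as exponent is the slope of the logarithm of the Gauss norm to the right of \<open>|\<rho>|\<close>.
\<close>

definition dominant :: "nat \<Rightarrow> 'c poly \<Rightarrow> 'c \<Rightarrow> nat \<Rightarrow> bool" where
  "dominant q u \<rho> i \<longleftrightarrow> coeff u i \<noteq> 0 \<and> (\<forall>k. vle (coeff u k * \<rho> ^ q ^ k) (coeff u i * \<rho> ^ q ^ i)) \<and>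
     (\<forall>k>i. vlt (coeff u k * \<rho> ^ q ^ k) (coeff u i * \<rho> ^ q ^ i))"

lemma dominantD:
  assumes "dominant q u \<rho> i"
  shows "coeff u i \<noteq> 0" "vle (coeff u k * \<rho> ^ q ^ k) (coeff u i * \<rho> ^ q ^ i)"
    "k > i \<Longrightarrow> vlt (coeff u k * \<rho> ^ q ^ k) (coeff u i * \<rho> ^ q ^ i)"
  using assms unfolding dominant_def by blast+

lemma dominant_unique: "dominant q u \<rho> i \<Longrightarrow> dominant q u \<rho> k \<Longrightarrow> i = k"
  by (metis dominantD(2,3) nat_neq_iff)

lemma dominant_exists:
  assumes "u \<noteq> 0" "\<rho> \<noteq> 0"
  obtains i where "dominant q u \<rho> i" "i \<le> degree u"
proof -
  define c where "c k = coeff u k * \<rho> ^ q ^ k" for k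
  have "\<exists>i\<le>n. \<forall>k\<le>n. vle (c k) (c i)" for n
  proof (induction n)
    case (Suc n)
    then obtain i where i: "i \<le> n" "\<forall>k\<le>n. vle (c k) (c i)" by blast
    show ?case
    proof (cases "vle (c (Suc n)) (c i)")
      case True
      then show ?thesis using i by (intro exI[of _ i]) (auto simp: le_Suc_eq)
    next
      case False
      then have "vle (c i) (c (Suc n))" using vle_total by blast
      then show ?thesis using i vle_trans by (intro exI[of _ "Suc n"]) (auto simp: le_Suc_eq)
    qed
  qed auto
  then obtain i0 where i0: "i0 \<le> degree u" "\<And>k. k \<le> degree u \<Longrightarrow> vle (c k) (c i0)" by metis
  have beyond: "c k = 0" if "k > degree u" for k using that by (simp add: c_def coeff_eq_0)
  define P where "P i \<longleftrightarrow> i \<le> degree u \<and> (\<forall>k. vle (c k) (c i))" for i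
  have "P i0" unfolding P_def using i0 beyond by (metis not_le vle_0)
  define i where "i = Greatest P"
  have i: "P i" unfolding i_def by (rule GreatestI_nat[of P i0 "degree u", OF \<open>P i0\<close>]) (simp add: P_def)
  have gr: "k \<le> i" if "P k" for k
    unfolding i_def by (rule Greatest_le_nat[of P k "degree u", OF that]) (simp add: P_def)
  have "c (degree u) \<noteq> 0" using assms by (simp add: c_def)
  then have ci: "c i \<noteq> 0" using i unfolding P_def by (metis vle_0_iff)
  have "vlt (c k) (c i)" if k: "k > i" for k
  proof (cases "k \<le> degree u")
    case True
    then obtain l where "\<not> vle (c l) (c k)" using gr k unfolding P_def by (metis not_le)
    then show ?thesis using i vle_trans unfolding P_def by blast
  qed (use beyond ci in auto)
  then have "dominant q u \<rho> i"
    unfolding dominant_def using i ci by (auto simp: c_def P_def)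
  then show thesis using that i by (auto simp: P_def)
qed

text \<open>
  Twisted multiplication is composition of additive polynomials, so Gauss norms compose and, by the
  chain rule for the slopes, dominant indices add up: \<open>w\<close> is taken at \<open>\<rho>\<close> and \<open>u\<close> at the radius to which
  \<open>w\<close> maps the disc of radius \<open>|\<rho>|\<close>.
\<close>

lemma dominant_mult:
  assumes q: "q > 0" and w: "dominant q w \<rho> j" and u: "dominant q u (coeff w j * \<rho> ^ q ^ j) i"
    and \<rho>: "\<rho> \<noteq> 0"
  shows "dominant q (twisted_mult q u w) \<rho> (i + j)"
    and "vle (coeff u i * (coeff w j * \<rho> ^ q ^ j) ^ q ^ i) (coeff (twisted_mult q u w) (i + j) * \<rho> ^ q ^ (i + j))"
    and "vle (coeff (twisted_mult q u w) (i + j) * \<rho> ^ q ^ (i + j)) (coeff u i * (coeff w j * \<rho> ^ q ^ j) ^ q ^ i)"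
proof -
  define \<sigma> where "\<sigma> = coeff w j * \<rho> ^ q ^ j"
  define \<mu> where "\<mu> = coeff u i * \<sigma> ^ q ^ i"
  define S where "S n = coeff (twisted_mult q u w) n * \<rho> ^ q ^ n" for n
  define t where "t n k = coeff u k * (coeff w (n - k) * \<rho> ^ q ^ (n - k)) ^ q ^ k" for n k
  have \<sigma>0: "\<sigma> \<noteq> 0" using dominantD(1)[OF w] \<rho> by (simp add: \<sigma>_def)
  have \<mu>0: "\<mu> \<noteq> 0" using dominantD(1)[OF u] \<sigma>0 by (simp add: \<mu>_def)
  have qk: "q ^ k > 0" for k using q by simp
  have S: "S n = (\<Sum>k\<le>n. t n k)" for n
    unfolding S_def coeff_twisted_mult[OF q] sum_distrib_right t_def
  proof (rule sum.cong[OF refl])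
    fix k assume "k \<in> {..n}"
    then have "q ^ n = q ^ (n - k) * q ^ k" by (simp flip: power_add)
    then have "\<rho> ^ q ^ n = (\<rho> ^ q ^ (n - k)) ^ q ^ k" by (simp only: power_mult)
    then show "coeff u k * coeff w (n - k) ^ q ^ k * \<rho> ^ q ^ n =
        coeff u k * (coeff w (n - k) * \<rho> ^ q ^ (n - k)) ^ q ^ k"
      by (simp only: power_mult_distrib mult.assoc)
  qed
  have le1: "vle (t n k) (coeff u k * \<sigma> ^ q ^ k)" for n k
    unfolding t_def \<sigma>_def by (intro vle_mult vle_refl vle_power dominantD(2)[OF w])
  have le2: "vle (coeff u k * \<sigma> ^ q ^ k) \<mu>" for k
    unfolding \<mu>_def using dominantD(2)[OF u] by (simp add: \<sigma>_def)
  have le: "vle (t n k) \<mu>" for n k using le1 le2 vle_trans by blast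
  have lt: "vlt (t n k) \<mu>" if "k > i \<or> n - k > j" for n k
    using that
  proof
    assume "k > i"
    then have "vlt (coeff u k * \<sigma> ^ q ^ k) \<mu>"
      unfolding \<mu>_def using dominantD(3)[OF u] by (simp add: \<sigma>_def)
    then show ?thesis using le1 vle_vlt_trans by blast
  next
    assume "n - k > j"
    show ?thesis
    proof (cases "coeff u k = 0")
      case True
      then show ?thesis using \<mu>0 by (simp add: t_def)
    next
      case False
      have "vlt ((coeff w (n - k) * \<rho> ^ q ^ (n - k)) ^ q ^ k) (\<sigma> ^ q ^ k)"
        unfolding \<sigma>_def using dominantD(3)[OF w \<open>n - k > j\<close>] qk by (rule vlt_power)
      from vlt_mult[OF this vle_refl False] have "vlt (t n k) (coeff u k * \<sigma> ^ q ^ k)"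
        by (simp add: t_def mult.commute)
      then show ?thesis using le2 vlt_vle_trans by blast
    qed
  qed
  have Sle: "vle (S n) \<mu>" for n unfolding S by (intro vle_sum le)
  have Slt: "vlt (S n) \<mu>" if "n > i + j" for n unfolding S
    by (rule vlt_sum[OF \<mu>0], rule lt) (use that in auto)
  have main: "vle \<mu> (S (i + j))"
  proof (rule ccontr)
    assume *: "vlt (S (i + j)) \<mu>"
    have "S (i + j) = t (i + j) i + (\<Sum>k\<in>{..i + j} - {i}. t (i + j) k)"
      unfolding S by (rule sum.remove) auto
    moreover have "t (i + j) i = \<mu>" by (simp add: t_def \<mu>_def \<sigma>_def)
    ultimately have eq: "\<mu> = S (i + j) + (\<Sum>k\<in>{..i + j} - {i}. - t (i + j) k)"
      by (simp add: sum_negf)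
    have "vlt (\<Sum>k\<in>{..i + j} - {i}. - t (i + j) k) \<mu>"
    proof (rule vlt_sum[OF \<mu>0])
      fix k assume "k \<in> {..i + j} - {i}"
      then have "vlt (t (i + j) k) \<mu>" by (intro lt) auto
      then show "vlt (- t (i + j) k) \<mu>" by (simp add: vle_uminus_right)
    qed
    from vlt_add[OF * this] show False using eq by simp
  qed
  have "S (i + j) \<noteq> 0" using main \<mu>0 by auto
  then have "coeff (twisted_mult q u w) (i + j) \<noteq> 0" by (simp add: S_def)
  moreover have "vle (S k) (S (i + j))" for k using Sle main vle_trans by blast
  moreover have "vlt (S k) (S (i + j))" if "k > i + j" for k
    using Slt[OF that] main vle_trans by blast
  ultimately show "dominant q (twisted_mult q u w) \<rho> (i + j)"
    unfolding dominant_def by (auto simp: S_def)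
  show "vle (coeff u i * (coeff w j * \<rho> ^ q ^ j) ^ q ^ i) (coeff (twisted_mult q u w) (i + j) * \<rho> ^ q ^ (i + j))"
    using main unfolding \<mu>_def \<sigma>_def S_def .
  show "vle (coeff (twisted_mult q u w) (i + j) * \<rho> ^ q ^ (i + j)) (coeff u i * (coeff w j * \<rho> ^ q ^ j) ^ q ^ i)"
    using Sle unfolding \<mu>_def \<sigma>_def S_def .
qed

end

text \<open>
  This description makes it evident that integral elements are closed under the ring operations.
\<close>

lemma integral_over_iff:
  assumes "unital_subring S"
  shows "integral_over S x \<longleftrightarrow> (\<forall>R. valuation_ring R \<and> S \<subseteq> R \<longrightarrow> x \<in> R)"
  using exists_valuation_ring_avoiding[OF assms, of x] valuation_ring.integral_mem[of _ S x] by metis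

section \<open>Twisted polynomials over an extension of a finite field\<close>

lemma finite_field_power_card:
  fixes a :: "'a :: {field, finite}"
  shows "a ^ CARD('a) = a"
proof (cases "a = 0")
  case False
  let ?U = "UNIV - {0 :: 'a}"
  have "bij_betw (\<lambda>x. a * x) ?U ?U"
    by (rule bij_betwI[of _ _ _ "\<lambda>x. x / a"]) (use False in auto)
  then have "(\<Prod>x\<in>?U. a * x) = (\<Prod>x\<in>?U. x)"
    by (rule prod.reindex_bij_betw)
  then have "a ^ card ?U * (\<Prod>x\<in>?U. x) = (\<Prod>x\<in>?U. x)"
    by (simp only: prod.distrib prod_constant)
  moreover have "(\<Prod>x\<in>?U. x) \<noteq> 0" by simp
  ultimately have "a ^ card ?U = 1" by (metis mult_cancel_right1)
  then have "a ^ Suc (card ?U) = a" by (simp only: power_Suc mult_1_right)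
  moreover have "CARD('a) = Suc (card ?U)"
    by (rule card.remove) auto
  ultimately show ?thesis by (simp only:)
qed simp

lemma card_field_gt_1: "CARD('a :: {field, finite}) > 1"
proof -
  have "card {0, 1 :: 'a} \<le> CARD('a)" by (rule card_mono) auto
  then show ?thesis by simp
qed

text \<open>
  The polynomial \<open>(X + 1)^q - X^q - 1\<close> has degree less than \<open>q\<close> and vanishes at the \<open>q\<close> elements of the
  finite field, hence it is zero. This avoids writing \<open>q\<close> as a power of the characteristic.
\<close>

lemma Frobenius_add_field_extension:
  fixes h :: "'a :: {field, finite} \<Rightarrow> 'b :: field"
  assumes inj: "inj h" and one: "h 1 = 1" and add: "\<And>a b. h (a + b) = h a + h b"
    and mult: "\<And>a b. h (a * b) = h a * h b"
  shows "(x + y :: 'b) ^ CARD('a) = x ^ CARD('a) + y ^ CARD('a)"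
proof -
  define q where "q = CARD('a)"
  have q: "q > 1" using card_field_gt_1 by (simp add: q_def)
  have h_power: "h a ^ n = h (a ^ n)" for a n by (induction n) (simp_all add: one mult)
  have hq: "h a ^ q = h a" for a by (simp add: h_power q_def finite_field_power_card)
  define p where "p = [:1, 1:] ^ q - monom 1 q - (1 :: 'b poly)"
  have "p = 0"
  proof (rule ccontr)
    assume "p \<noteq> 0"
    have "poly p (h a) = 0" for a
      using hq[of "1 + a"] hq[of a] by (simp add: p_def poly_monom add one)
    then have "card (range h) \<le> card {x. poly p x = 0}"
      by (intro card_mono poly_roots_finite \<open>p \<noteq> 0\<close>) auto
    also have "\<dots> \<le> degree p" by (rule card_poly_roots_bound) fact
    finally have "q \<le> degree p" using inj by (simp add: card_image q_def)
    moreover have "degree p < q"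
    proof (rule degree_lessI)
      show "p \<noteq> 0 \<or> 0 < q" using q by simp
      have dq: "degree ([:1, 1:] ^ q :: 'b poly) = q" by (simp add: degree_power_eq)
      have "coeff ([:1, 1:] ^ q :: 'b poly) q = 1"
        using lead_coeff_power[of "[:1, 1 :: 'b:]" q] dq by simp
      then show "\<forall>k\<ge>q. coeff p k = 0"
        using q dq by (auto simp: p_def coeff_eq_0 le_less)
    qed
    ultimately show False by simp
  qed
  then have *: "(1 + z) ^ q = z ^ q + 1" for z :: 'b
  proof -
    have "poly p z = 0" using \<open>p = 0\<close> by simp
    then show ?thesis
      by (simp only: p_def poly_diff poly_power poly_monom) (simp add: algebra_simps)
  qed
  show ?thesis
  proof (cases "y = 0")
    case False
    have "x + y = y * (1 + x / y)" using False by (simp add: field_simps)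
    then have "(x + y) ^ q = (y * (1 + x / y)) ^ q" by simp
    also have "\<dots> = x ^ q + y ^ q"
      unfolding power_mult_distrib * using False by (simp add: field_simps)
    finally show ?thesis by (simp add: q_def)
  qed (use q in \<open>simp add: q_def\<close>)
qed

locale poly_ring_embedding =
  fixes \<iota> :: "'a :: {field, finite} poly \<Rightarrow> 'c :: field" and q :: nat
  assumes q_eq: "q = CARD('a)"
    and hom_1: "\<iota> 1 = 1"
    and hom_add: "\<iota> (a + b) = \<iota> a + \<iota> b"
    and hom_mult: "\<iota> (a * b) = \<iota> a * \<iota> b"
    and hom_eq_0_iff: "\<iota> a = 0 \<longleftrightarrow> a = 0"
begin

definition t :: 'c where "t = \<iota> [:0, 1:]"

lemma q_gt_1: "q > 1" unfolding q_eq by (rule card_field_gt_1)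

lemma q_pos [simp]: "q > 0" using q_gt_1 by linarith

lemma hom_0: "\<iota> 0 = 0" by (simp add: hom_eq_0_iff)

lemma hom_uminus: "\<iota> (- a) = - \<iota> a"
  using hom_add[of a "- a"] by (simp add: hom_0 eq_neg_iff_add_eq_0 add.commute)

lemma hom_diff: "\<iota> (a - b) = \<iota> a - \<iota> b"
  using hom_add[of a "- b"] by (simp add: hom_uminus)

lemma hom_eq_iff: "\<iota> a = \<iota> b \<longleftrightarrow> a = b"
  using hom_eq_0_iff[of "a - b"] by (simp add: hom_diff)

lemma hom_power: "\<iota> (a ^ n) = \<iota> a ^ n"
  by (induction n) (auto simp: hom_1 hom_mult)

lemma hom_pCons: "\<iota> (pCons c a) = \<iota> [:c:] + t * \<iota> a"
proof -
  have "pCons c a = [:c:] + [:0, 1:] * a" by simp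
  then show ?thesis unfolding t_def by (metis hom_add hom_mult)
qed

lemma hom_const_power_q: "\<iota> [:c:] ^ q = \<iota> [:c:]"
proof -
  have "[:c:] ^ n = [:c ^ n:]" for n by (induction n) (auto simp: one_pCons)
  then show ?thesis by (metis hom_power finite_field_power_card q_eq)
qed

lemma unital_subring_range: "unital_subring (range \<iota>)"
proof
  show "1 \<in> range \<iota>" using hom_1 by (metis rangeI)
  show "x - y \<in> range \<iota>" "x * y \<in> range \<iota>" if "x \<in> range \<iota>" "y \<in> range \<iota>" for x y
    using that hom_diff hom_mult by (auto simp flip: hom_diff hom_mult)
qed

lemma t_power_neq: "n > 0 \<Longrightarrow> t ^ q ^ n \<noteq> t"
proof
  assume n: "n > 0" and eq: "t ^ q ^ n = t"
  have "\<iota> ([:0, 1:] ^ q ^ n) = \<iota> [:0, 1:]" using eq by (simp add: t_def hom_power)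
  then have "[:0, 1:] ^ q ^ n = [:0, 1 :: 'a:]" by (simp add: hom_eq_iff)
  then have "degree ([:0, 1 :: 'a:] ^ q ^ n) = 1" by simp
  moreover have "degree ([:0, 1 :: 'a:] ^ q ^ n) = q ^ n" by (simp add: degree_power_eq)
  moreover have "q ^ n > 1" by (rule one_less_power[OF q_gt_1 n])
  ultimately show False by linarith
qed

lemma Frobenius_add: "(x + y :: 'c) ^ q ^ n = x ^ q ^ n + y ^ q ^ n"
proof (induction n)
  case (Suc n)
  have "(x + y) ^ q = x ^ q + y ^ q" for x y :: 'c
    unfolding q_eq by (rule Frobenius_add_field_extension[of "\<lambda>c. \<iota> [:c:]"])
       (auto intro!: injI simp: hom_eq_iff hom_1 simp flip: one_pCons hom_add hom_mult)
  then show ?case using Suc by (simp add: power_mult mult.commute[of q])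
qed simp

lemma Frobenius_0: "(0 :: 'c) ^ q ^ n = 0"
  using q_gt_1 by (simp add: power_0_left)

lemma Frobenius_sum: "(\<Sum>i\<in>I. f i :: 'c) ^ q ^ n = (\<Sum>i\<in>I. f i ^ q ^ n)"
  by (induction I rule: infinite_finite_induct) (auto simp: Frobenius_add Frobenius_0)

abbreviation tmult :: "'c poly \<Rightarrow> 'c poly \<Rightarrow> 'c poly" (infixl "\<odot>\<^sub>\<tau>" 70) where
  "u \<odot>\<^sub>\<tau> w \<equiv> twisted_mult q u w"

lemma coeff_tmult: "coeff (u \<odot>\<^sub>\<tau> w) n = (\<Sum>k\<le>n. coeff u k * coeff w (n - k) ^ q ^ k)"
  using coeff_twisted_mult q_gt_1 by (metis gr_zeroI not_less_zero)

lemma tmult_assoc: "(a \<odot>\<^sub>\<tau> b) \<odot>\<^sub>\<tau> c = a \<odot>\<^sub>\<tau> (b \<odot>\<^sub>\<tau> c)"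
proof (rule poly_eqI)
  fix n
  define F where "F i j k = coeff a i * coeff b j ^ q ^ i * coeff c k ^ q ^ (i + j)" for i j k
  have "coeff ((a \<odot>\<^sub>\<tau> b) \<odot>\<^sub>\<tau> c) n = (\<Sum>j=0..n. \<Sum>i=0..j. F i (j - i) (n - j))"
    by (simp add: coeff_tmult sum_distrib_right F_def atMost_atLeast0)
  also have "\<dots> = (\<Sum>j=0..n. \<Sum>i=0..n - j. F j i (n - j - i))"
    by (rule fps_mult_assoc_lemma)
  also have "\<dots> = coeff (a \<odot>\<^sub>\<tau> (b \<odot>\<^sub>\<tau> c)) n"
    by (simp add: coeff_tmult sum_distrib_left F_def atMost_atLeast0 Frobenius_sum
        power_mult_distrib power_add mult.assoc mult.commute flip: power_mult)
  finally show "coeff ((a \<odot>\<^sub>\<tau> b) \<odot>\<^sub>\<tau> c) n = coeff (a \<odot>\<^sub>\<tau> (b \<odot>\<^sub>\<tau> c)) n" .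
qed

lemma tmult_distrib_right: "(a + b) \<odot>\<^sub>\<tau> c = a \<odot>\<^sub>\<tau> c + b \<odot>\<^sub>\<tau> c"
  by (rule poly_eqI) (simp add: coeff_tmult distrib_right sum.distrib)

lemma tmult_distrib_left: "c \<odot>\<^sub>\<tau> (a + b) = c \<odot>\<^sub>\<tau> a + c \<odot>\<^sub>\<tau> b"
  by (rule poly_eqI) (simp add: coeff_tmult distrib_left sum.distrib Frobenius_add)

lemma tmult_0_left [simp]: "0 \<odot>\<^sub>\<tau> c = 0"
  by (rule poly_eqI) (simp add: coeff_tmult)

lemma degree_tmult:
  assumes "u \<noteq> 0" "w \<noteq> 0"
  shows "degree (u \<odot>\<^sub>\<tau> w) = degree u + degree w"
proof (rule antisym)
  have zero: "coeff u k * coeff w (n - k) ^ q ^ k = 0"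
    if "n > degree u + degree w \<or> k \<noteq> degree u" "n \<ge> degree u + degree w" "k \<le> n" for n k
    using that by (cases "k > degree u") (auto simp: coeff_eq_0 Frobenius_0)
  show "degree (u \<odot>\<^sub>\<tau> w) \<le> degree u + degree w"
    by (rule degree_le) (auto simp: coeff_tmult zero)
  have "coeff (u \<odot>\<^sub>\<tau> w) (degree u + degree w) =
      (\<Sum>k\<in>{degree u}. coeff u k * coeff w (degree u + degree w - k) ^ q ^ k)"
    unfolding coeff_tmult by (rule sum.mono_neutral_right) (use zero in auto)
  then have "coeff (u \<odot>\<^sub>\<tau> w) (degree u + degree w) \<noteq> 0" using assms by simp
  then show "degree u + degree w \<le> degree (u \<odot>\<^sub>\<tau> w)" by (rule le_degree)
qed

lemma coeff_drinfeld_T: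
  "coeff (drinfeld_T \<iota> g \<Delta>) 0 = t" "coeff (drinfeld_T \<iota> g \<Delta>) (Suc 0) = g"
  "coeff (drinfeld_T \<iota> g \<Delta>) (Suc (Suc 0)) = \<Delta>"
  "coeff (drinfeld_T \<iota> g \<Delta>) 2 = \<Delta>"
  "k > 2 \<Longrightarrow> coeff (drinfeld_T \<iota> g \<Delta>) k = 0"
  by (auto simp: drinfeld_T_def t_def coeff_pCons numeral_2_eq_2 split: nat.split)

lemma coeff_tmult_drinfeld_T:
  "coeff (u \<odot>\<^sub>\<tau> drinfeld_T \<iota> g \<Delta>) 0 = coeff u 0 * t"
  "coeff (u \<odot>\<^sub>\<tau> drinfeld_T \<iota> g \<Delta>) (Suc 0) = coeff u (Suc 0) * t ^ q + coeff u 0 * g"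
  "coeff (u \<odot>\<^sub>\<tau> drinfeld_T \<iota> g \<Delta>) (Suc (Suc n)) =
     coeff u (Suc (Suc n)) * t ^ q ^ Suc (Suc n) + coeff u (Suc n) * g ^ q ^ Suc n + coeff u n * \<Delta> ^ q ^ n"
proof -
  let ?P = "drinfeld_T \<iota> g \<Delta>"
  show "coeff (u \<odot>\<^sub>\<tau> ?P) 0 = coeff u 0 * t" "coeff (u \<odot>\<^sub>\<tau> ?P) (Suc 0) = coeff u (Suc 0) * t ^ q + coeff u 0 * g"
    by (simp_all add: coeff_tmult coeff_drinfeld_T)
  have "coeff (u \<odot>\<^sub>\<tau> ?P) (Suc (Suc n)) =
      (\<Sum>k\<in>{n, Suc n, Suc (Suc n)}. coeff u k * coeff ?P (Suc (Suc n) - k) ^ q ^ k)"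
    unfolding coeff_tmult
    by (rule sum.mono_neutral_right) (auto simp: coeff_drinfeld_T Frobenius_0)
  then show "coeff (u \<odot>\<^sub>\<tau> ?P) (Suc (Suc n)) =
     coeff u (Suc (Suc n)) * t ^ q ^ Suc (Suc n) + coeff u (Suc n) * g ^ q ^ Suc n + coeff u n * \<Delta> ^ q ^ n"
    by (simp add: coeff_drinfeld_T)
qed

lemma coeff_drinfeld_T_tmult:
  "coeff (drinfeld_T \<iota> g \<Delta> \<odot>\<^sub>\<tau> u) 0 = t * coeff u 0"
  "coeff (drinfeld_T \<iota> g \<Delta> \<odot>\<^sub>\<tau> u) (Suc 0) = t * coeff u (Suc 0) + g * coeff u 0 ^ q"
  "coeff (drinfeld_T \<iota> g \<Delta> \<odot>\<^sub>\<tau> u) (Suc (Suc n)) =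
     t * coeff u (Suc (Suc n)) + g * coeff u (Suc n) ^ q + \<Delta> * coeff u n ^ q ^ 2"
proof -
  let ?P = "drinfeld_T \<iota> g \<Delta>"
  show "coeff (?P \<odot>\<^sub>\<tau> u) 0 = t * coeff u 0" "coeff (?P \<odot>\<^sub>\<tau> u) (Suc 0) = t * coeff u (Suc 0) + g * coeff u 0 ^ q"
    by (simp_all add: coeff_tmult coeff_drinfeld_T)
  have "coeff (?P \<odot>\<^sub>\<tau> u) (Suc (Suc n)) =
      (\<Sum>k\<in>{0, Suc 0, Suc (Suc 0)}. coeff ?P k * coeff u (Suc (Suc n) - k) ^ q ^ k)"
    unfolding coeff_tmult
    by (rule sum.mono_neutral_right) (auto simp: coeff_drinfeld_T)
  then show "coeff (?P \<odot>\<^sub>\<tau> u) (Suc (Suc n)) =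
     t * coeff u (Suc (Suc n)) + g * coeff u (Suc n) ^ q + \<Delta> * coeff u n ^ q ^ 2"
    by (simp add: coeff_drinfeld_T power2_eq_square)
qed

text \<open>
  Comparing coefficients in \<open>u \<Phi>\<^sub>T = \<Phi>\<^sub>T u\<close> gives a recursion that determines \<open>u\<close> from its constant
  term, since \<open>T^(q^n) - T\<close> is invertible for \<open>n > 0\<close>.
\<close>

lemma mem_drinfeld_End_iff:
  "u \<in> drinfeld_End \<iota> g \<Delta> \<longleftrightarrow>
     coeff u (Suc 0) * (t ^ q - t) = g * coeff u 0 ^ q - g * coeff u 0 \<and>
     (\<forall>n. coeff u (Suc (Suc n)) * (t ^ q ^ Suc (Suc n) - t) =
        g * coeff u (Suc n) ^ q - g ^ q ^ Suc n * coeff u (Suc n)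
        + \<Delta> * coeff u n ^ q ^ 2 - \<Delta> ^ q ^ n * coeff u n)"
proof -
  let ?P = "drinfeld_T \<iota> g \<Delta>"
  have all: "(\<forall>n. P n) \<longleftrightarrow> P 0 \<and> P (Suc 0) \<and> (\<forall>n. P (Suc (Suc n)))" for P
    by (metis not0_implies_Suc)
  have "u \<in> drinfeld_End \<iota> g \<Delta> \<longleftrightarrow> (\<forall>n. coeff (u \<odot>\<^sub>\<tau> ?P) n = coeff (?P \<odot>\<^sub>\<tau> u) n)"
    by (auto simp: drinfeld_End_def poly_eq_iff q_eq)
  also have "\<dots> \<longleftrightarrow> coeff u (Suc 0) * (t ^ q - t) = g * coeff u 0 ^ q - g * coeff u 0 \<and>
     (\<forall>n. coeff u (Suc (Suc n)) * (t ^ q ^ Suc (Suc n) - t) =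
        g * coeff u (Suc n) ^ q - g ^ q ^ Suc n * coeff u (Suc n)
        + \<Delta> * coeff u n ^ q ^ 2 - \<Delta> ^ q ^ n * coeff u n)"
  proof -
    have 1: "coeff u (Suc 0) * t ^ q + coeff u 0 * g = t * coeff u (Suc 0) + g * coeff u 0 ^ q \<longleftrightarrow>
        coeff u (Suc 0) * (t ^ q - t) = g * coeff u 0 ^ q - g * coeff u 0"
      by (auto simp: algebra_simps)
    have 2: "A * x + B * b + C * c = t * A + g * D + E \<longleftrightarrow> A * (x - t) = g * D - b * B + E - c * C"
      for A B C D E x b c
      by (auto simp: algebra_simps)
    show ?thesis
      unfolding all[of "\<lambda>n. coeff (u \<odot>\<^sub>\<tau> ?P) n = coeff (?P \<odot>\<^sub>\<tau> u) n"]
        coeff_tmult_drinfeld_T coeff_drinfeld_T_tmult 1 2 by (simp add: mult.commute)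
  qed
  finally show ?thesis .
qed

lemma End_add: "u \<in> drinfeld_End \<iota> g \<Delta> \<Longrightarrow> w \<in> drinfeld_End \<iota> g \<Delta> \<Longrightarrow> u + w \<in> drinfeld_End \<iota> g \<Delta>"
  by (simp add: drinfeld_End_def tmult_distrib_left tmult_distrib_right flip: q_eq)

lemma End_tmult: "u \<in> drinfeld_End \<iota> g \<Delta> \<Longrightarrow> w \<in> drinfeld_End \<iota> g \<Delta> \<Longrightarrow> u \<odot>\<^sub>\<tau> w \<in> drinfeld_End \<iota> g \<Delta>"
  unfolding drinfeld_End_def q_eq[symmetric] mem_Collect_eq by (metis tmult_assoc)

lemma End_const: "[:\<iota> [:c:]:] \<in> drinfeld_End \<iota> g \<Delta>"
proof -
  have "\<iota> [:c:] ^ q ^ n = \<iota> [:c:]" for n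
    by (induction n) (simp_all add: power_mult hom_const_power_q)
  then show ?thesis
    unfolding mem_drinfeld_End_iff by (auto simp: coeff_pCons hom_const_power_q Frobenius_0 split: nat.split)
qed

lemma End_drinfeld_T: "drinfeld_T \<iota> g \<Delta> \<in> drinfeld_End \<iota> g \<Delta>"
  by (simp add: drinfeld_End_def)

lemma End_eqI:
  assumes "u \<in> drinfeld_End \<iota> g \<Delta>" "w \<in> drinfeld_End \<iota> g \<Delta>" "coeff u 0 = coeff w 0"
  shows "u = w"
proof -
  note u = assms(1)[unfolded mem_drinfeld_End_iff] and w = assms(2)[unfolded mem_drinfeld_End_iff]
  have "coeff u n = coeff w n \<and> coeff u (Suc n) = coeff w (Suc n)" for n
  proof (induction n)
    case 0
    have "coeff u (Suc 0) * (t ^ q - t) = coeff w (Suc 0) * (t ^ q - t)"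
      using u w assms(3) by simp
    then show ?case using t_power_neq[of "Suc 0"] assms(3) by simp
  next
    case (Suc n)
    then have "coeff u (Suc (Suc n)) * (t ^ q ^ Suc (Suc n) - t) = coeff w (Suc (Suc n)) * (t ^ q ^ Suc (Suc n) - t)"
      using u w by metis
    then show ?case using t_power_neq[of "Suc (Suc n)"] Suc by simp
  qed
  then show ?thesis by (simp add: poly_eq_iff)
qed

end

context poly_ring_embedding
begin

section \<open>Endomorphisms and the value of the Drinfeld module at D\<close>

text \<open>
  The action \<open>\<Phi>\<^sub>a\<close> of \<open>a\<close>, computed by the Horner scheme.
\<close>

definition drinfeld_map :: "'c \<Rightarrow> 'c \<Rightarrow> 'a poly \<Rightarrow> 'c poly" where
  "drinfeld_map g \<Delta> a = fold_coeffs (\<lambda>c \<psi>. [:\<iota> [:c:]:] + \<psi> \<odot>\<^sub>\<tau> drinfeld_T \<iota> g \<Delta>) a 0"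

lemma drinfeld_map_0 [simp]: "drinfeld_map g \<Delta> 0 = 0"
  by (simp add: drinfeld_map_def)

lemma drinfeld_map_pCons:
  "drinfeld_map g \<Delta> (pCons c a) = [:\<iota> [:c:]:] + drinfeld_map g \<Delta> a \<odot>\<^sub>\<tau> drinfeld_T \<iota> g \<Delta>"
  by (cases "c = 0 \<and> a = 0")
    (auto simp: drinfeld_map_def fold_coeffs_pCons_not_0_0_eq fold_coeffs_pCons_coeff_not_0_eq hom_0)

lemma drinfeld_map_mem_End: "drinfeld_map g \<Delta> a \<in> drinfeld_End \<iota> g \<Delta>"
proof (induction a)
  case 0
  show ?case using End_const[of 0] by (simp add: hom_0)
next
  case (pCons c a)
  then show ?case
    unfolding drinfeld_map_pCons by (intro End_add End_const End_tmult End_drinfeld_T)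
qed

lemma coeff_0_drinfeld_map: "coeff (drinfeld_map g \<Delta> a) 0 = \<iota> a"
proof (induction a)
  case (pCons c a)
  then show ?case by (simp add: drinfeld_map_pCons hom_pCons[of c a] coeff_tmult_drinfeld_T)
qed (simp add: hom_0)

lemma degree_drinfeld_map:
  assumes "\<Delta> \<noteq> 0" "a \<noteq> 0"
  shows "degree (drinfeld_map g \<Delta> a) = 2 * degree a"
  using assms(2)
proof (induction a)
  case (pCons c a)
  show ?case
  proof (cases "a = 0")
    case False
    have "drinfeld_map g \<Delta> a \<noteq> 0"
      using coeff_0_drinfeld_map[of g \<Delta> a] False hom_eq_0_iff by fastforce
    moreover have "degree (drinfeld_T \<iota> g \<Delta>) = 2" "drinfeld_T \<iota> g \<Delta> \<noteq> 0"
      using assms by (auto simp: drinfeld_T_def)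
    ultimately have "degree (drinfeld_map g \<Delta> a \<odot>\<^sub>\<tau> drinfeld_T \<iota> g \<Delta>) = 2 * degree a + 2"
      using pCons False by (simp add: degree_tmult)
    then show ?thesis using False unfolding drinfeld_map_pCons
      by (subst degree_add_eq_right) auto
  qed (simp add: drinfeld_map_pCons)
qed simp

text \<open>
  Both sides are endomorphisms with constant term \<open>D\<close>.
\<close>

lemma drinfeld_End_square:
  assumes u: "u \<in> drinfeld_End \<iota> g \<Delta>" and s: "coeff u 0 ^ 2 = \<iota> D"
  shows "u \<odot>\<^sub>\<tau> u = drinfeld_map g \<Delta> D"
  by (rule End_eqI[OF End_tmult[OF u u] drinfeld_map_mem_End])
    (use s in \<open>simp add: coeff_tmult coeff_0_drinfeld_map power2_eq_square\<close>)

lemma drinfeld_End_degree: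
  assumes u: "u \<in> drinfeld_End \<iota> g \<Delta>" and s: "coeff u 0 ^ 2 = \<iota> D"
    and "\<Delta> \<noteq> 0" "D \<noteq> 0"
  shows "degree u = degree D"
proof -
  have u0: "u \<noteq> 0" using s assms(4) hom_eq_0_iff[of D] by auto
  have "degree u + degree u = 2 * degree D"
    using degree_tmult[OF u0 u0] degree_drinfeld_map[OF assms(3,4), of g]
    unfolding drinfeld_End_square[OF u s] by linarith
  then show ?thesis by simp
qed

text \<open>
  Modulo the maximal ideal, \<open>\<Phi>\<^sub>T\<close> becomes \<open>T + \<tau>\<close>, a Drinfeld module of rank one. Hence \<open>\<Phi>\<^sub>a\<close> reduces to
  a twisted polynomial of degree \<open>deg a\<close>, and the degree of the reduction is the dominant index at
  radius 1.
\<close>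

lemma dominant_drinfeld_map:
  assumes "valuation_ring R" and A: "range \<iota> \<subseteq> R" and y: "\<not> valuation_ring.vle R 1 y" and "a \<noteq> 0"
  shows "valuation_ring.dominant R q (drinfeld_map 1 y a) 1 (degree a)"
    and "coeff (drinfeld_map 1 y a) (degree a) \<in> R"
    and "valuation_ring.vle R 1 (coeff (drinfeld_map 1 y a) (degree a))"
proof -
  interpret valuation_ring R by fact
  have const: "\<iota> b \<in> R" for b using A by auto
  have tR: "t \<in> R" by (simp add: t_def const)
  have yR: "y \<in> R" using vlt_imp_vle[OF y] by (simp add: vle_1_iff)
  have yn: "vlt (y ^ q ^ n) 1" for n using vlt_power[OF y, of "q ^ n"] by simp
  let ?\<psi> = "drinfeld_map 1 y"
  have *: "(\<forall>i. coeff (?\<psi> a) i \<in> R) \<and> (\<forall>i>degree a. vlt (coeff (?\<psi> a) i) 1) \<and>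
      vle 1 (coeff (?\<psi> a) (degree a))"
    using \<open>a \<noteq> 0\<close>
  proof (induction a)
    case (pCons c a)
    show ?case
    proof (cases "a = 0")
      case True
      then have "c \<noteq> 0" using pCons by simp
      then have "\<iota> [:c:] * \<iota> [:inverse c:] = 1"
        by (simp add: hom_1 flip: hom_mult one_pCons)
      then have "vle 1 (\<iota> [:c:])" unfolding vle_def using const by (metis mult.commute)
      then show ?thesis using True const
        by (auto simp: drinfeld_map_pCons coeff_pCons zero_mem split: nat.split)
    next
      case False
      define \<psi> where "\<psi> = ?\<psi> a"
      define d where "d = degree a"
      have IH: "coeff \<psi> i \<in> R" "i > d \<Longrightarrow> vlt (coeff \<psi> i) 1" "vle 1 (coeff \<psi> d)" for i
        using pCons.IH False by (auto simp: \<psi>_def d_def)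
      have deg: "degree (pCons c a) = Suc d" using False by (simp add: d_def)
      have small: "vlt (x * b) 1" "vlt (b * x) 1" if "vlt x 1" "b \<in> R" for x b
        using vlt_mult[OF that(1), of b 1] that(2) by (auto simp: vle_1_iff mult.commute)
      have 0: "coeff (?\<psi> (pCons c a)) 0 = \<iota> [:c:] + coeff \<psi> 0 * t"
        by (simp add: drinfeld_map_pCons coeff_tmult_drinfeld_T \<psi>_def)
      have 1: "coeff (?\<psi> (pCons c a)) (Suc 0) = coeff \<psi> (Suc 0) * t ^ q + coeff \<psi> 0"
        by (simp add: drinfeld_map_pCons coeff_tmult_drinfeld_T \<psi>_def)
      have 2: "coeff (?\<psi> (pCons c a)) (Suc (Suc n)) =
          coeff \<psi> (Suc (Suc n)) * t ^ q ^ Suc (Suc n) + coeff \<psi> (Suc n) + coeff \<psi> n * y ^ q ^ n" for n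
        by (simp only: drinfeld_map_pCons coeff_add coeff_tmult_drinfeld_T \<psi>_def) simp
      have yqR: "y ^ n \<in> R" for n using yR power_mem by blast
      have integral: "coeff (?\<psi> (pCons c a)) i \<in> R" for i
      proof (cases i)
        case (Suc i')
        then show ?thesis using IH tR yqR
          by (cases i') (auto simp: 1 2 simp del: power_Suc intro!: add_mem mult_mem power_mem yR)
      qed (use 0 IH tR const in \<open>auto intro!: add_mem mult_mem\<close>)
      have high: "vlt (coeff (?\<psi> (pCons c a)) i) 1" if i: "i > Suc d" for i
      proof -
        obtain n where n: "i = Suc (Suc n)" using i by (cases i; cases "i - 1") auto
        then have "d < Suc n" using i by simp
        then show ?thesis unfolding n 2
          by (intro vlt_add small yn IH power_mem tR) auto
      qed
      have "vle 1 (coeff (?\<psi> (pCons c a)) (Suc d))"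
      proof (rule ccontr)
        assume neg: "vlt (coeff (?\<psi> (pCons c a)) (Suc d)) 1"
        have "\<exists>r. coeff (?\<psi> (pCons c a)) (Suc d) = coeff \<psi> d + r \<and> vlt r 1"
        proof (cases d)
          case 0
          have "vlt (coeff \<psi> (Suc 0) * t ^ q) 1" by (intro small IH power_mem tR) (simp add: 0)
          then show ?thesis using 0 1 by (auto simp: add.commute)
        next
          case (Suc n)
          have "vlt (coeff \<psi> (Suc (Suc n)) * t ^ q ^ Suc (Suc n) + coeff \<psi> n * y ^ q ^ n) 1"
            by (intro vlt_add small IH power_mem tR yn) (simp add: Suc)
          then show ?thesis unfolding Suc 2 by (intro exI conjI) auto
        qed
        then obtain r where r: "coeff (?\<psi> (pCons c a)) (Suc d) = coeff \<psi> d + r" "vlt r 1" by blast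
        then have "vlt (- r) 1" by (simp add: vle_uminus_right)
        from vlt_add[OF neg this] show False using r IH(3) by simp
      qed
      then show ?thesis unfolding deg using integral high by blast
    qed
  qed simp
  define c where "c = coeff (?\<psi> a) (degree a)"
  have c: "c \<in> R" "vle 1 c" using * by (auto simp: c_def)
  then show "coeff (?\<psi> a) (degree a) \<in> R" "vle 1 (coeff (?\<psi> a) (degree a))"
    by (simp_all add: c_def)
  have "c \<noteq> 0" using c(2) by auto
  moreover have "vle (coeff (?\<psi> a) k) c" for k
    using * c(2) vle_trans[of _ 1 c] by (simp add: vle_1_iff)
  moreover have "vlt (coeff (?\<psi> a) k) c" if "k > degree a" for k
    using * that vle_trans[OF c(2)] by blast
  ultimately show "dominant q (?\<psi> a) 1 (degree a)"
    unfolding dominant_def c_def power_one mult_1_right by blast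
qed

text \<open>
  With \<open>y = 1/j\<close>, the conclusion is \<open>|j| \<le> 1\<close>. If \<open>|y| < 1\<close>, then \<open>u\<^sup>2 = \<Phi>\<^sub>D\<close> has dominant index \<open>deg D\<close>
  and Gauss norm 1 at radius 1. The second fact forces the Gauss norm of \<open>u\<close> to be 1 as well, and then
  the first one reads \<open>2 I = deg D\<close> for the dominant index \<open>I\<close> of \<open>u\<close>, contrary to the parity of \<open>deg D\<close>.
\<close>

theorem potential_good_reduction:
  assumes u: "u \<in> drinfeld_End \<iota> 1 y" and s: "coeff u 0 ^ 2 = \<iota> D" and odd: "odd (degree D)"
    and "valuation_ring R" and A: "range \<iota> \<subseteq> R"
  shows "valuation_ring.vle R 1 y"
proof (rule ccontr)
  interpret valuation_ring R by fact
  assume y: "vlt y 1"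
  have D0: "D \<noteq> 0" using odd by auto
  define d where "d = degree D"
  note dom = dominant_drinfeld_map[OF \<open>valuation_ring R\<close> A y D0, folded d_def]
  note sq = drinfeld_End_square[OF u s]
  have "u \<noteq> 0" using s D0 hom_eq_0_iff[of D] by auto
  then obtain I where I: "dominant q u 1 I" using dominant_exists[of u 1] by auto
  define \<sigma> where "\<sigma> = coeff u I"
  have \<sigma>0: "\<sigma> \<noteq> 0" using dominantD(1)[OF I] by (simp add: \<sigma>_def)
  have le_\<sigma>: "vle (coeff u k) \<sigma>" for k using dominantD(2)[OF I, of k] by (simp add: \<sigma>_def)
  have lt_\<sigma>: "vlt (coeff u k) \<sigma>" if "k > I" for k using dominantD(3)[OF I that] by (simp add: \<sigma>_def)
  obtain i where i: "dominant q u \<sigma> i" using dominant_exists[OF \<open>u \<noteq> 0\<close> \<sigma>0] by auto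
  have i': "dominant q u (coeff u I * 1 ^ q ^ I) i" using i by (simp add: \<sigma>_def)
  note prod = dominant_mult[OF q_pos I i' one_neq_zero, unfolded sq]
  have iI: "i + I = d" using dominant_unique[OF prod(1) dom(1)] .
  (* |m| is the Gauss norm of u^2 at radius 1 *)
  define m where "m = coeff u i * \<sigma> ^ q ^ i"
  have m1: "vle m 1" "vle 1 m"
  proof -
    have "vle (coeff (drinfeld_map 1 y D) d) 1" using dom(2) vle_1_iff by blast
    then show "vle m 1" using prod(2) unfolding iI m_def \<sigma>_def power_one mult_1_right
      by (rule vle_trans[rotated])
    show "vle 1 m" using dom(3) prod(3) unfolding iI m_def \<sigma>_def power_one mult_1_right
      by (rule vle_trans)
  qed
  have "vle \<sigma> 1"
  proof (rule ccontr)
    assume gt: "vlt 1 \<sigma>"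
    then have "vle (1 ^ q ^ I) (\<sigma> ^ q ^ I)" by (intro vle_power vlt_imp_vle)
    from vlt_mult[OF gt this] have "vlt 1 (\<sigma> * \<sigma> ^ q ^ I)" using \<sigma>0 by simp
    moreover have "vle (\<sigma> * \<sigma> ^ q ^ I) m" using dominantD(2)[OF i, of I] by (simp add: m_def \<sigma>_def)
    ultimately show False using m1 vle_trans by blast
  qed
  moreover have "vle 1 \<sigma>"
  proof (rule ccontr)
    assume lt: "vlt \<sigma> 1"
    then have "vle (\<sigma> ^ q ^ i) (1 ^ q ^ i)" by (intro vle_power vlt_imp_vle)
    from vlt_mult[OF lt this] have "vlt (\<sigma> * \<sigma> ^ q ^ i) 1" by simp
    moreover have "vle m (\<sigma> * \<sigma> ^ q ^ i)" unfolding m_def by (intro vle_mult le_\<sigma> vle_refl)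
    ultimately show False using m1 vle_trans by blast
  qed
  ultimately have unit: "vle (\<sigma> ^ n) 1" "vle 1 (\<sigma> ^ n)" for n
    using vle_power[of \<sigma> 1 n] vle_power[of 1 \<sigma> n] by simp_all
  have up: "vle (coeff u k * \<sigma> ^ q ^ k) (coeff u k)" for k
    using vle_mult[OF vle_refl unit(1)] by simp
  have down: "vle \<sigma> (\<sigma> * \<sigma> ^ q ^ I)" using vle_mult[OF vle_refl unit(2)] by simp
  have "dominant q u \<sigma> I"
    unfolding dominant_def \<sigma>_def[symmetric]
  proof (intro conjI allI impI)
    show "vle (coeff u k * \<sigma> ^ q ^ k) (\<sigma> * \<sigma> ^ q ^ I)" for k
      using vle_trans[OF vle_trans[OF up le_\<sigma>] down] .
    show "vlt (coeff u k * \<sigma> ^ q ^ k) (\<sigma> * \<sigma> ^ q ^ I)" if "k > I" for k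
      using vle_vlt_trans[OF up lt_\<sigma>[OF that]] vle_trans[OF down] by blast
  qed (rule \<sigma>0)
  then have "i = I" using dominant_unique i by blast
  then have "degree D = 2 * I" using iI by (simp add: d_def)
  then show False using odd by simp
qed

text \<open>
  For \<open>\<gamma> = c^(q-1)\<close> this is conjugation by \<open>c\<close>, an isomorphism of Drinfeld modules. As only \<open>\<gamma>\<close> enters
  the formulas, no root \<open>c\<close> has to exist; \<open>G n\<close> stands for \<open>c^(q^n - 1)\<close>.
\<close>

lemma drinfeld_End_scale:
  assumes u: "u \<in> drinfeld_End \<iota> g \<Delta>" and \<gamma>: "\<gamma> \<noteq> 0"
  obtains u' where "u' \<in> drinfeld_End \<iota> (g / \<gamma>) (\<Delta> / \<gamma> ^ Suc q)" "coeff u' 0 = coeff u 0"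
    "degree u' = degree u"
proof -
  define G where "G = rec_nat (1 :: 'c) (\<lambda>_ x. \<gamma> * x ^ q)"
  have G0: "G 0 = 1" and GS: "G (Suc n) = \<gamma> * G n ^ q" for n by (simp_all add: G_def)
  have Gnz: "G n \<noteq> 0" for n by (induction n) (auto simp: G0 GS \<gamma>)
  have GS': "G (Suc n) = G n * \<gamma> ^ q ^ n" for n
  proof (induction n)
    case (Suc n)
    have "G (Suc (Suc n)) = \<gamma> * (G n * \<gamma> ^ q ^ n) ^ q" using GS[of "Suc n"] Suc by simp
    then show ?case by (simp add: GS power_mult_distrib mult.commute flip: power_mult)
  qed (simp add: G0 GS)
  have GSS: "G (Suc (Suc n)) = \<gamma> ^ Suc q * G n ^ q ^ 2" for n
    by (simp add: GS power_mult_distrib power2_eq_square flip: power_mult)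
  have GSS': "G (Suc (Suc n)) = G n * (\<gamma> ^ Suc q) ^ q ^ n" for n
    by (simp add: GS' power_mult_distrib flip: power_mult)
  define u' where "u' = (\<Sum>n\<le>degree u. monom (coeff u n / G n) n)"
  have u': "coeff u' n = coeff u n / G n" for n
    by (auto simp: u'_def coeff_sum coeff_eq_0)
  note E = u[unfolded mem_drinfeld_End_iff]
  show thesis
  proof (rule that)
    show "coeff u' 0 = coeff u 0" by (simp add: u' G0)
    show "degree u' = degree u"
    proof (cases "u = 0")
      case False
      show ?thesis
      proof (rule antisym)
        show "degree u' \<le> degree u" by (rule degree_le) (auto simp: u' coeff_eq_0)
        show "degree u \<le> degree u'" by (rule le_degree) (use False Gnz in \<open>auto simp: u'\<close>)
      qed
    qed (simp add: u'_def)
    show "u' \<in> drinfeld_End \<iota> (g / \<gamma>) (\<Delta> / \<gamma> ^ Suc q)"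
      unfolding mem_drinfeld_End_iff
    proof (intro conjI allI)
      have "coeff u' (Suc 0) * (t ^ q - t) = (coeff u (Suc 0) * (t ^ q - t)) / \<gamma>"
        by (simp add: u' GS G0)
      also have "\<dots> = (g * coeff u 0 ^ q - g * coeff u 0) / \<gamma>" using E by simp
      also have "\<dots> = g / \<gamma> * coeff u' 0 ^ q - g / \<gamma> * coeff u' 0"
        by (simp add: u' G0 diff_divide_distrib)
      finally show "coeff u' (Suc 0) * (t ^ q - t) = g / \<gamma> * coeff u' 0 ^ q - g / \<gamma> * coeff u' 0" .
      fix n
      let ?G = "G (Suc (Suc n))"
      have "coeff u' (Suc (Suc n)) * (t ^ q ^ Suc (Suc n) - t) =
          (coeff u (Suc (Suc n)) * (t ^ q ^ Suc (Suc n) - t)) / ?G"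
        by (simp only: u' times_divide_eq_left)
      also have "\<dots> = (g * coeff u (Suc n) ^ q - g ^ q ^ Suc n * coeff u (Suc n)
          + \<Delta> * coeff u n ^ q ^ 2 - \<Delta> ^ q ^ n * coeff u n) / ?G" using E by metis
      also have "\<dots> = g * coeff u (Suc n) ^ q / ?G - g ^ q ^ Suc n * coeff u (Suc n) / ?G
          + \<Delta> * coeff u n ^ q ^ 2 / ?G - \<Delta> ^ q ^ n * coeff u n / ?G"
        by (simp only: add_divide_distrib diff_divide_distrib)
      also have "g * coeff u (Suc n) ^ q / ?G = g / \<gamma> * coeff u' (Suc n) ^ q"
        unfolding u' GS[of "Suc n"] by (simp add: power_divide)
      also have "g ^ q ^ Suc n * coeff u (Suc n) / ?G = (g / \<gamma>) ^ q ^ Suc n * coeff u' (Suc n)"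
        unfolding u' GS'[of "Suc n"] by (simp add: power_divide mult.commute)
      also have "\<Delta> * coeff u n ^ q ^ 2 / ?G = \<Delta> / \<gamma> ^ Suc q * coeff u' n ^ q ^ 2"
        unfolding u' GSS by (simp add: power_divide)
      also have "\<Delta> ^ q ^ n * coeff u n / ?G = (\<Delta> / \<gamma> ^ Suc q) ^ q ^ n * coeff u' n"
        unfolding u' GSS' by (simp only: power_divide times_divide_times_eq mult.commute)
      finally show "coeff u' (Suc (Suc n)) * (t ^ q ^ Suc (Suc n) - t) =
        g / \<gamma> * coeff u' (Suc n) ^ q - (g / \<gamma>) ^ q ^ Suc n * coeff u' (Suc n)
        + \<Delta> / \<gamma> ^ Suc q * coeff u' n ^ q ^ 2 - (\<Delta> / \<gamma> ^ Suc q) ^ q ^ n * coeff u' n" .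
    qed
  qed
qed

text \<open>
  Modulo the maximal ideal, \<open>\<Phi>\<^sub>T\<close> becomes \<open>T + \<tau>\<^sup>2\<close>, the module with \<open>j = 0\<close>. The recursion for the
  coefficients of \<open>u\<close> then relates only indices of equal parity, and when \<open>T^(q^n) - T\<close> is a unit for all
  odd \<open>n\<close> it makes all coefficients of odd index vanish. The leading coefficient, however, is a root of
  unity, so its index is even.
\<close>

theorem even_degree_of_reduction_to_j_0:
  assumes u: "u \<in> drinfeld_End \<iota> g 1" "u \<noteq> 0"
    and "valuation_ring R" and A: "range \<iota> \<subseteq> R" and g: "\<not> valuation_ring.vle R 1 g"
    and unit: "\<And>n. odd n \<Longrightarrow> valuation_ring.vle R 1 (t ^ q ^ n - t)"
  shows "even (degree u)"
proof (rule ccontr)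
  interpret valuation_ring R by fact
  assume odd: "odd (degree u)"
  have tR: "t \<in> R" using A by (auto simp: t_def)
  have gR: "g \<in> R" using vlt_imp_vle[OF g] by (simp add: vle_1_iff)
  define d where "d = degree u"
  have E: "coeff u (Suc (Suc n)) * (t ^ q ^ Suc (Suc n) - t) =
        g * coeff u (Suc n) ^ q - g ^ q ^ Suc n * coeff u (Suc n) + coeff u n ^ q ^ 2 - coeff u n" for n
    using u(1) unfolding mem_drinfeld_End_iff by simp
  (* x is a root of a monic polynomial over R, so the coefficients of u are integral from the top down *)
  have root_mem: "x \<in> R" if x: "x ^ q ^ 2 - x \<in> R" for x
  proof (rule ccontr)
    assume nx: "x \<notin> R"
    then have x0: "x \<noteq> 0" and ix: "inverse x \<in> R" using zero_mem total_mem by auto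
    define m where "m = q ^ 2 - 2"
    have "q ^ 2 \<ge> 2" using one_less_power[OF q_gt_1, of 2] by simp
    then have m: "q ^ 2 = Suc (Suc m)" by (simp add: m_def)
    have "(x ^ q ^ 2 - x) * inverse x ^ Suc m = x - inverse x ^ m"
      using x0 by (simp add: m field_simps)
    then have "x = (x ^ q ^ 2 - x) * inverse x ^ Suc m + inverse x ^ m" by simp
    moreover have "(x ^ q ^ 2 - x) * inverse x ^ Suc m + inverse x ^ m \<in> R"
      by (intro add_mem mult_mem power_mem ix x)
    ultimately show False using nx by simp
  qed
  have "coeff u (d - i) \<in> R \<and> coeff u (Suc (d - i)) \<in> R" for i
  proof (induction i)
    case 0
    have "coeff u (Suc (Suc d)) = 0" "coeff u (Suc d) = 0" by (auto simp: d_def coeff_eq_0)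
    then have "coeff u d ^ q ^ 2 - coeff u d = 0" using E[of d] by (simp add: zero_power)
    then show ?case using root_mem[of "coeff u d"] \<open>coeff u (Suc d) = 0\<close> by (simp add: zero_mem)
  next
    case (Suc i)
    show ?case
    proof (cases "i < d")
      case True
      define n where "n = d - Suc i"
      have n: "d - i = Suc n" using True by (simp add: n_def)
      have IH: "coeff u (Suc n) \<in> R" "coeff u (Suc (Suc n)) \<in> R" using Suc by (auto simp: n)
      have "coeff u n ^ q ^ 2 - coeff u n = coeff u (Suc (Suc n)) * (t ^ q ^ Suc (Suc n) - t) -
          (g * coeff u (Suc n) ^ q - g ^ q ^ Suc n * coeff u (Suc n))"
        using E[of n] by (simp only: algebra_simps)
      also have "\<dots> \<in> R" by (intro diff_mem mult_mem power_mem IH tR gR)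
      finally show ?thesis unfolding n_def[symmetric] using root_mem IH(1) by blast
    qed (use Suc in simp)
  qed
  then have uR: "coeff u n \<in> R" for n
    by (metis coeff_eq_0 d_def diff_diff_cancel not_le zero_mem)
  have small: "vlt (x * b) 1" if "vlt x 1" "b \<in> R" for x b
    using vlt_mult[OF that(1), of b 1] that(2) by (auto simp: vle_1_iff)
  have cancel: "vlt x 1" if "vlt (x * b) 1" "vle 1 b" for x b
    using that vle_mult[of 1 x 1 b] by auto
  have gpow: "vlt (g ^ n) 1" if "n > 0" for n using vlt_power[OF g that] by simp
  have neg: "vlt (- x) 1 \<longleftrightarrow> vlt x 1" for x by (simp add: vle_uminus_right)
  have "vlt (coeff u (Suc (2 * n))) 1" for n
  proof (induction n)
    case 0
    have "coeff u (Suc 0) * (t ^ q - t) = g * (coeff u 0 ^ q - coeff u 0)"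
      using u(1) unfolding mem_drinfeld_End_iff by (simp add: algebra_simps)
    also have "vlt (g * (coeff u 0 ^ q - coeff u 0)) 1"
      by (intro small g diff_mem power_mem uR)
    finally show ?case using cancel unit[of 1] by simp
  next
    case (Suc n)
    define m where "m = Suc (2 * n)"
    have IH: "vlt (coeff u m) 1" using Suc by (simp add: m_def)
    have "vlt (coeff u m ^ q ^ 2) 1" using vlt_power[OF IH, of "q ^ 2"] by simp
    moreover have "vlt (g * coeff u (Suc m) ^ q) 1" by (intro small g power_mem uR)
    moreover have "vlt (- (g ^ q ^ Suc m * coeff u (Suc m))) 1"
      unfolding neg by (intro small gpow uR) simp
    moreover have "vlt (- coeff u m) 1" unfolding neg by (rule IH)
    ultimately have "vlt (g * coeff u (Suc m) ^ q + - (g ^ q ^ Suc m * coeff u (Suc m)) + coeff u m ^ q ^ 2 + - coeff u m) 1"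
      by (intro vlt_add)
    then have "vlt (coeff u (Suc (Suc m)) * (t ^ q ^ Suc (Suc m) - t)) 1"
      unfolding E by simp
    then have "vlt (coeff u (Suc (Suc m))) 1"
      by (rule cancel) (rule unit, simp add: m_def)
    then show ?case by (simp add: m_def)
  qed
  moreover obtain n where "d = Suc (2 * n)" using odd by (metis d_def oddE Suc_eq_plus1)
  ultimately have lt: "vlt (coeff u d) 1" by simp
  have "coeff u (Suc (Suc d)) = 0" "coeff u (Suc d) = 0" by (auto simp: d_def coeff_eq_0)
  then have "coeff u d * coeff u d ^ (q ^ 2 - 1) = coeff u d * 1"
    using E[of d] by (simp add: zero_power flip: power_Suc)
  moreover have "coeff u d \<noteq> 0" using u(2) by (simp add: d_def)
  ultimately have one: "coeff u d ^ (q ^ 2 - 1) = 1" by (simp only: mult_cancel_left) simp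
  have "q ^ 2 - 1 > 0" using one_less_power[OF q_gt_1, of 2] by simp
  from vlt_power[OF lt this] show False using one by simp
qed

end

context poly_ring_embedding
begin

section \<open>The coefficients of an endomorphism as polynomials in 1/j\<close>

abbreviation eval_poly :: "'a poly poly \<Rightarrow> 'c \<Rightarrow> 'c" where
  "eval_poly p x \<equiv> poly (map_poly \<iota> p) x"

lemma eval_poly_pCons: "eval_poly (pCons a p) x = \<iota> a + x * eval_poly p x"
  by (simp add: map_poly_pCons hom_0)

lemma eval_poly_add: "eval_poly (p + r) x = eval_poly p x + eval_poly r x"
  by (induction p r rule: poly_induct2) (simp_all add: eval_poly_pCons hom_add algebra_simps)

lemma eval_poly_smult: "eval_poly (smult a p) x = \<iota> a * eval_poly p x"
  by (induction p) (simp_all add: eval_poly_pCons hom_mult hom_0 algebra_simps)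

lemma eval_poly_mult: "eval_poly (p * r) x = eval_poly p x * eval_poly r x"
  by (induction p) (simp_all add: eval_poly_pCons eval_poly_add eval_poly_smult hom_0 algebra_simps)

text \<open>
  These are the functions given by polynomials with coefficients in the fraction field of \<open>A\<close>; a common
  denominator is split off so that only polynomials over \<open>A\<close> occur.
\<close>

definition rational_poly_fun :: "('c \<Rightarrow> 'c) \<Rightarrow> bool" where
  "rational_poly_fun f \<longleftrightarrow> (\<exists>b B. b \<noteq> 0 \<and> (\<forall>x. \<iota> b * f x = eval_poly B x))"

lemma rational_poly_fun_const: "rational_poly_fun (\<lambda>x. \<iota> a)"
  unfolding rational_poly_fun_def
  by (intro exI[of _ 1] exI[of _ "[:a:]"]) (simp add: hom_1 hom_0 eval_poly_pCons)

lemma rational_poly_fun_id: "rational_poly_fun (\<lambda>x. x)"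
  unfolding rational_poly_fun_def
  by (intro exI[of _ 1] exI[of _ "[:0, 1:]"]) (simp add: hom_1 hom_0 eval_poly_pCons)

lemma rational_poly_fun_add:
  assumes "rational_poly_fun f" "rational_poly_fun g"
  shows "rational_poly_fun (\<lambda>x. f x + g x)"
proof -
  obtain b B c C where b: "b \<noteq> 0" "\<And>x. \<iota> b * f x = eval_poly B x"
    and c: "c \<noteq> 0" "\<And>x. \<iota> c * g x = eval_poly C x"
    using assms unfolding rational_poly_fun_def by metis
  have "\<iota> (b * c) * (f x + g x) = eval_poly (smult c B + smult b C) x" for x
    by (simp add: eval_poly_add eval_poly_smult hom_mult algebra_simps flip: b c)
  then show ?thesis unfolding rational_poly_fun_def using b(1) c(1) by (metis mult_eq_0_iff)
qed

lemma rational_poly_fun_mult: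
  assumes "rational_poly_fun f" "rational_poly_fun g"
  shows "rational_poly_fun (\<lambda>x. f x * g x)"
proof -
  obtain b B c C where b: "b \<noteq> 0" "\<And>x. \<iota> b * f x = eval_poly B x"
    and c: "c \<noteq> 0" "\<And>x. \<iota> c * g x = eval_poly C x"
    using assms unfolding rational_poly_fun_def by metis
  have "\<iota> (b * c) * (f x * g x) = eval_poly (B * C) x" for x
    by (simp add: eval_poly_mult hom_mult algebra_simps flip: b c)
  then show ?thesis unfolding rational_poly_fun_def using b(1) c(1) by (metis mult_eq_0_iff)
qed

lemma rational_poly_fun_power: "rational_poly_fun f \<Longrightarrow> rational_poly_fun (\<lambda>x. f x ^ n)"
proof (induction n)
  case 0
  then show ?case using rational_poly_fun_const[of 1] by (simp add: hom_1)
qed (simp add: rational_poly_fun_mult)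

lemma rational_poly_fun_diff:
  assumes "rational_poly_fun f" "rational_poly_fun g"
  shows "rational_poly_fun (\<lambda>x. f x - g x)"
  using rational_poly_fun_add[OF assms(1) rational_poly_fun_mult[OF rational_poly_fun_const[of "- 1"] assms(2)]]
  by (simp add: hom_uminus hom_1)

lemma rational_poly_fun_divide:
  assumes "rational_poly_fun f" "a \<noteq> 0"
  shows "rational_poly_fun (\<lambda>x. f x / \<iota> a)"
proof -
  obtain b B where b: "b \<noteq> 0" "\<And>x. \<iota> b * f x = eval_poly B x"
    using assms(1) unfolding rational_poly_fun_def by metis
  have "\<iota> (b * a) * (f x / \<iota> a) = eval_poly B x" for x
    using assms(2) by (simp add: hom_mult hom_eq_0_iff flip: b(2))
  then show ?thesis unfolding rational_poly_fun_def using b(1) assms(2) by (metis mult_eq_0_iff)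
qed

text \<open>
  For \<open>g = 1\<close> and \<open>\<Delta> = y\<close>, the coefficients of the endomorphism with constant term \<open>s\<close>, \<open>s\<^sup>2 = D\<close>, are
  \<open>s\<close> times these polynomials in \<open>y\<close>. For odd \<open>q\<close> we have \<open>s^q = D^((q-1)/2) s\<close>, which is how the square
  root disappears from the recursion.
\<close>

fun cm_coeff :: "'a poly \<Rightarrow> 'c \<Rightarrow> nat \<Rightarrow> 'c" where
  "cm_coeff D y 0 = 1"
| "cm_coeff D y (Suc 0) = (\<iota> D ^ ((q - 1) div 2) - 1) / (t ^ q - t)"
| "cm_coeff D y (Suc (Suc n)) =
     (\<iota> D ^ ((q - 1) div 2) * cm_coeff D y (Suc n) ^ q - cm_coeff D y (Suc n)
      + y * (\<iota> D ^ ((q ^ 2 - 1) div 2) * cm_coeff D y n ^ q ^ 2) - y ^ q ^ n * cm_coeff D y n)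
     / (t ^ q ^ Suc (Suc n) - t)"

lemma rational_poly_fun_cm_coeff:
  "rational_poly_fun (\<lambda>y. cm_coeff D y n)"
proof (induction n rule: less_induct)
  case (less n)
  have t: "t ^ q ^ k - t = \<iota> ([:0, 1:] ^ q ^ k - [:0, 1:])" for k
    by (simp add: t_def hom_diff hom_power)
  have tn: "[:0, 1:] ^ q ^ k - [:0, 1:] \<noteq> (0 :: 'a poly)" if "k > 0" for k
    using t_power_neq[OF that] t[of k] hom_0 by auto
  consider "n = 0" | "n = Suc 0" | m where "n = Suc (Suc m)"
    by (metis not0_implies_Suc)
  then show ?case
  proof cases
    case 1
    then show ?thesis using rational_poly_fun_const[of 1] by (simp add: hom_1)
  next
    case 2
    have "rational_poly_fun (\<lambda>y. (\<iota> D ^ ((q - 1) div 2) - \<iota> 1) / \<iota> ([:0, 1:] ^ q ^ 1 - [:0, 1:]))"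
      by (intro rational_poly_fun_divide rational_poly_fun_diff rational_poly_fun_power
          rational_poly_fun_const tn) simp
    then show ?thesis using 2 unfolding t[symmetric] by (simp add: hom_1)
  next
    case (3 m)
    have "rational_poly_fun (\<lambda>y. (\<iota> D ^ ((q - 1) div 2) * cm_coeff D y (Suc m) ^ q - cm_coeff D y (Suc m)
      + y * (\<iota> D ^ ((q ^ 2 - 1) div 2) * cm_coeff D y m ^ q ^ 2) - y ^ q ^ m * cm_coeff D y m)
     / \<iota> ([:0, 1:] ^ q ^ Suc (Suc m) - [:0, 1:]))"
      by (intro rational_poly_fun_divide rational_poly_fun_diff rational_poly_fun_add rational_poly_fun_mult
          rational_poly_fun_power rational_poly_fun_const rational_poly_fun_id tn less) (auto simp: 3)
    then show ?thesis unfolding 3 cm_coeff.simps t[symmetric] .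
  qed
qed

lemma odd_power_sqrt:
  assumes "odd n" "s ^ 2 = d"
  shows "s ^ n = d ^ ((n - 1) div 2) * (s :: 'c)"
proof -
  obtain m where "n = Suc (2 * m)" using assms(1) by (metis oddE Suc_eq_plus1)
  then show ?thesis using assms(2) by (simp add: power_mult)
qed

lemma cm_coeff_recursion:
  fixes s y :: 'c
  assumes "odd q" and s: "s ^ 2 = \<iota> D"
  defines "c \<equiv> \<lambda>n. s * cm_coeff D y n"
  shows "c 0 = s" and "c (Suc 0) * (t ^ q - t) = c 0 ^ q - c 0"
    and "c (Suc (Suc n)) * (t ^ q ^ Suc (Suc n) - t) =
      c (Suc n) ^ q - c (Suc n) + y * c n ^ q ^ 2 - y ^ q ^ n * c n"
proof -
  have sq: "s ^ q = \<iota> D ^ ((q - 1) div 2) * s" "s ^ q ^ 2 = \<iota> D ^ ((q ^ 2 - 1) div 2) * s"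
    using assms by (intro odd_power_sqrt; simp)+
  show "c 0 = s" by (simp add: c_def)
  show "c (Suc 0) * (t ^ q - t) = c 0 ^ q - c 0"
  proof -
    have "cm_coeff D y (Suc 0) * (t ^ q - t) = \<iota> D ^ ((q - 1) div 2) - 1"
      using t_power_neq[of 1] by simp
    from arg_cong[OF this, of "\<lambda>x. s * x"] show ?thesis
      unfolding c_def sq cm_coeff.simps(1) mult_1_right by (simp only: algebra_simps mult_1_left)
  qed
  have "cm_coeff D y (Suc (Suc n)) * (t ^ q ^ Suc (Suc n) - t) =
      \<iota> D ^ ((q - 1) div 2) * cm_coeff D y (Suc n) ^ q - cm_coeff D y (Suc n)
      + y * (\<iota> D ^ ((q ^ 2 - 1) div 2) * cm_coeff D y n ^ q ^ 2) - y ^ q ^ n * cm_coeff D y n"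
    using t_power_neq[of "Suc (Suc n)"] by (simp only: cm_coeff.simps) simp
  from arg_cong[OF this, of "\<lambda>x. s * x"]
  show "c (Suc (Suc n)) * (t ^ q ^ Suc (Suc n) - t) =
      c (Suc n) ^ q - c (Suc n) + y * c n ^ q ^ 2 - y ^ q ^ n * c n"
    unfolding c_def power_mult_distrib sq by (simp only: algebra_simps)
qed

lemma coeff_drinfeld_End_eq_cm_coeff:
  assumes "odd q" and u: "u \<in> drinfeld_End \<iota> 1 y" and s: "coeff u 0 ^ 2 = \<iota> D"
  shows "coeff u n = coeff u 0 * cm_coeff D y n"
proof -
  define c where "c n = coeff u 0 * cm_coeff D y n" for n
  note rec = cm_coeff_recursion[OF assms(1) s, of y, folded c_def]
  note E = u[unfolded mem_drinfeld_End_iff]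
  have "coeff u n = c n \<and> coeff u (Suc n) = c (Suc n)"
  proof (induction n)
    case 0
    have "coeff u (Suc 0) * (t ^ q - t) = c (Suc 0) * (t ^ q - t)"
      using E rec(1,2) by simp
    then show ?case using t_power_neq[of 1] rec(1) by simp
  next
    case (Suc n)
    have "coeff u (Suc (Suc n)) * (t ^ q ^ Suc (Suc n) - t) =
        coeff u (Suc n) ^ q - coeff u (Suc n) + y * coeff u n ^ q ^ 2 - y ^ q ^ n * coeff u n"
      using E by simp
    also have "\<dots> = c (Suc (Suc n)) * (t ^ q ^ Suc (Suc n) - t)" using Suc rec(3) by metis
    finally show ?case using t_power_neq[of "Suc (Suc n)"] Suc by simp
  qed
  then show ?thesis by (simp add: c_def)
qed

text \<open>
  Complex multiplication by a square root of \<open>D\<close> is thus expressed by the vanishing of polynomials over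
  the fraction field of \<open>A\<close> at \<open>y\<close>, and so it passes to the conjugates of \<open>y\<close>.
\<close>

lemma drinfeld_End_if_cm_coeff_zero:
  assumes "odd q" and s: "s ^ 2 = \<iota> D" and zero: "\<And>n. n > m \<Longrightarrow> cm_coeff D y n = 0"
  obtains u where "u \<in> drinfeld_End \<iota> 1 y" "coeff u 0 = s"
proof -
  define u where "u = (\<Sum>n\<le>m. monom (s * cm_coeff D y n) n)"
  have u: "coeff u n = s * cm_coeff D y n" for n
    using zero by (auto simp: u_def coeff_sum)
  note rec = cm_coeff_recursion[OF assms(1) s, of y, folded u]
  show thesis
  proof (rule that)
    show "u \<in> drinfeld_End \<iota> 1 y"
      unfolding mem_drinfeld_End_iff using rec(2,3) by simp
    show "coeff u 0 = s" by (rule rec(1))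
  qed
qed

lemma integral_over_range_iff:
  "integral_over (range \<iota>) x \<longleftrightarrow> (\<exists>p :: 'a poly poly. lead_coeff p = 1 \<and> eval_poly p x = 0)"
proof
  assume "integral_over (range \<iota>) x"
  then obtain r where r: "lead_coeff r = 1" "\<And>i. coeff r i \<in> range \<iota>" "poly r x = 0"
    unfolding integral_over_def by blast
  define p where "p = map_poly (inv_into UNIV \<iota>) r"
  have inj: "inj \<iota>" by (auto intro: injI simp: hom_eq_iff)
  have inv0: "inv_into UNIV \<iota> 0 = 0" using inv_f_f[OF inj, of 0] by (simp add: hom_0)
  have p: "map_poly \<iota> p = r"
    using r(2) by (intro poly_eqI) (auto simp: p_def coeff_map_poly inv0 hom_0 f_inv_into_f)
  have "degree p = degree r"
  proof (rule antisym)
    show "degree p \<le> degree r" unfolding p_def by (rule map_poly_degree_leq)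
    show "degree r \<le> degree p" using map_poly_degree_leq[of \<iota> p] by (simp add: p)
  qed
  moreover have "\<iota> (coeff p n) = coeff r n" for n by (simp add: coeff_map_poly hom_0 flip: p)
  ultimately have "\<iota> (lead_coeff p) = \<iota> 1" using r(1) by (simp add: hom_1)
  then show "\<exists>p :: 'a poly poly. lead_coeff p = 1 \<and> eval_poly p x = 0"
    using p r(3) by (auto simp: hom_eq_iff)
next
  assume "\<exists>p :: 'a poly poly. lead_coeff p = 1 \<and> eval_poly p x = 0"
  then obtain p :: "'a poly poly" where p: "lead_coeff p = 1" "eval_poly p x = 0" by blast
  have "degree (map_poly \<iota> p) = degree p"
    by (rule map_poly_degree_eq) (simp add: hom_eq_0_iff p(1))
  then show "integral_over (range \<iota>) x"
    unfolding integral_over_def using p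
    by (intro exI[of _ "map_poly \<iota> p"]) (auto simp: coeff_map_poly hom_0 hom_1)
qed

text \<open>
  Working with pseudo-division, a minimal polynomial is taken over \<open>A\<close> instead of its fraction field.
\<close>

lemma minimal_polynomial:
  assumes "p \<noteq> 0" "eval_poly p x = 0" "x \<noteq> 0"
  obtains f :: "'a poly poly" where "f \<noteq> 0" "eval_poly f x = 0" "coeff f 0 \<noteq> 0"
    "\<And>h z. eval_poly h x = 0 \<Longrightarrow> eval_poly f z = 0 \<Longrightarrow> eval_poly h z = 0"
proof -
  define P where "P f \<longleftrightarrow> f \<noteq> 0 \<and> eval_poly f x = 0" for f :: "'a poly poly"
  obtain f where f: "P f" and min: "\<And>g. degree g < degree f \<Longrightarrow> \<not> P g"
    using ex_has_least_nat[of P p degree] assms(1,2) unfolding P_def by (metis not_le)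
  show thesis
  proof (rule that)
    show "f \<noteq> 0" "eval_poly f x = 0" using f by (auto simp: P_def)
    show "coeff f 0 \<noteq> 0"
    proof
      assume "coeff f 0 = 0"
      then obtain g where g: "f = pCons 0 g" by (metis coeff_pCons_0 pCons_cases)
      then have "P g" using f assms(3) by (auto simp: P_def eval_poly_pCons hom_0)
      moreover have "g \<noteq> 0" using g f by (auto simp: P_def)
      then have "degree g < degree f" using g by simp
      ultimately show False using min by blast
    qed
    fix h z assume h: "eval_poly h x = 0" and z: "eval_poly f z = 0"
    obtain a r where ar: "a \<noteq> 0" "smult a h = f * r + pseudo_mod h f"
      using pseudo_mod(1)[OF \<open>f \<noteq> 0\<close>] by blast
    have ev: "\<iota> a * eval_poly h w = eval_poly f w * eval_poly r w + eval_poly (pseudo_mod h f) w" for w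
      using arg_cong[OF ar(2), of "\<lambda>p. eval_poly p w"]
      by (simp add: eval_poly_add eval_poly_mult eval_poly_smult)
    have "eval_poly (pseudo_mod h f) x = 0" using ev[of x] h f by (simp add: P_def)
    then have "pseudo_mod h f = 0"
      using pseudo_mod(2)[OF \<open>f \<noteq> 0\<close>, of h] min unfolding P_def by blast
    then show "eval_poly h z = 0" using ev[of z] z ar(1) by (simp add: hom_eq_0_iff)
  qed
qed

end

section \<open>The infinite place\<close>

locale infinite_absolute_value = poly_ring_embedding \<iota> q
  for \<iota> :: "'a :: {field, finite} poly \<Rightarrow> 'c :: field" and q :: nat +
  fixes v :: "'c \<Rightarrow> real"
  assumes v_nonneg: "0 \<le> v z"
    and v_eq_0_iff: "v z = 0 \<longleftrightarrow> z = 0"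
    and v_mult: "v (z * w) = v z * v w"
    and v_ultrametric: "v (z + w) \<le> max (v z) (v w)"
    and v_hom: "a \<noteq> 0 \<Longrightarrow> v (\<iota> a) = real q ^ degree a"
begin

lemma v_1: "v 1 = 1"
  using v_mult[of 1 1] v_eq_0_iff[of 1] by simp

lemma v_0: "v 0 = 0"
  by (simp add: v_eq_0_iff)

lemma v_pos: "x \<noteq> 0 \<Longrightarrow> v x > 0"
  using v_nonneg[of x] v_eq_0_iff[of x] by linarith

lemma v_power: "v (x ^ n) = v x ^ n"
  by (induction n) (simp_all add: v_1 v_mult)

lemma v_uminus: "v (- x) = v x"
proof -
  have "v (- 1) * v (- 1) = 1" using v_mult[of "- 1" "- 1"] by (simp add: v_1)
  then have "v (- 1) = 1" using v_nonneg[of "- 1"] by (metis abs_of_nonneg abs_square_eq_1 power2_eq_square)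
  then show ?thesis using v_mult[of "- 1" x] by simp
qed

lemma v_divide: "v (x / y) = v x / v y"
proof (cases "y = 0")
  case False
  have "v (x / y) * v y = v x" using False by (simp flip: v_mult)
  then show ?thesis using v_pos[OF False] by (simp add: field_simps)
qed (simp add: v_0)

lemma v_t: "v t = real q"
  using v_hom[of "[:0, 1:]"] by (simp add: t_def)

lemma valuation_ring_v: "valuation_ring {x. v x \<le> 1}"
proof
  show "1 \<in> {x. v x \<le> 1}" by (simp add: v_1)
  fix x y
  assume "x \<in> {x. v x \<le> 1}" "y \<in> {x. v x \<le> 1}"
  then show "x - y \<in> {x. v x \<le> 1}" "x * y \<in> {x. v x \<le> 1}"
    using v_ultrametric[of x "- y"] by (auto simp: v_uminus v_mult v_nonneg mult_le_one)
next
  fix x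
  show "x \<in> {x. v x \<le> 1} \<or> inverse x \<in> {x. v x \<le> 1}"
    by (cases "v x \<le> 1") (auto simp: inverse_eq_divide v_divide v_1 divide_le_eq)
qed

interpretation V: valuation_ring "{x. v x \<le> 1}"
  by (rule valuation_ring_v)

lemma vle_iff: "V.vle x y \<longleftrightarrow> v x \<le> v y"
proof
  assume "V.vle x y"
  then obtain r where "v r \<le> 1" "x = r * y" unfolding V.vle_def by blast
  then show "v x \<le> v y" using v_nonneg[of y] by (simp add: v_mult mult_left_le_one_le v_nonneg)
next
  assume le: "v x \<le> v y"
  show "V.vle x y"
  proof (cases "y = 0")
    case True
    then have "x = 0" using le v_pos[of x] by (cases "x = 0") (auto simp: v_0)
    then show ?thesis by simp
  next
    case False
    then have "v (x / y) \<le> 1" using le v_pos[OF False] by (simp add: v_divide)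
    then show ?thesis unfolding V.vle_def using False by (intro bexI[of _ "x / y"]) auto
  qed
qed

lemma dominantI:
  assumes "coeff u i \<noteq> 0" and "\<And>k. k \<noteq> i \<Longrightarrow> v (coeff u k * \<rho> ^ q ^ k) < v (coeff u i * \<rho> ^ q ^ i)"
  shows "V.dominant q u \<rho> i"
  unfolding V.dominant_def vle_iff using assms by (metis less_imp_le nat_neq_iff not_le order_refl)

text \<open>
  Suppose \<open>|y| \<ge> 1\<close>. Then the middle term of \<open>\<Phi>\<^sub>T = T + \<tau> + y \<tau>\<^sup>2\<close> is dominant at no radius, so all dominant
  indices of \<open>\<Phi>\<^sub>T\<close> are even. As \<open>u\<close> commutes with \<open>\<Phi>\<^sub>T\<close>, its dominant index has the same parity at a
  radius \<open>r\<close> and at the radius to which \<open>\<Phi>\<^sub>T\<close> maps the disc of radius \<open>r\<close>, which is at least \<open>q r\<close>.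
  Iterating leads from small radii, where the index is 0, to large ones, where it is \<open>deg u\<close>.
\<close>

theorem abs_inverse_j_less_1:
  assumes u: "u \<in> drinfeld_End \<iota> 1 y" and odd: "odd (degree u)"
  shows "v y < 1"
proof (rule ccontr)
  assume "\<not> v y < 1"
  then have y: "v y \<ge> 1" by simp
  have q1: "real q > 1" using q_gt_1 by simp
  define \<Phi> where "\<Phi> = drinfeld_T \<iota> 1 y"
  note \<Phi> = coeff_drinfeld_T[where g = 1 and \<Delta> = y, folded \<Phi>_def]
  have "u \<noteq> 0" using odd by auto
  have u0: "coeff u 0 \<noteq> 0"
  proof
    assume "coeff u 0 = 0"
    then have "u = 0" using End_eqI[OF u, of 0] End_const[of 0] by (simp add: hom_0)
    then show False using \<open>u \<noteq> 0\<close> by simp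
  qed
  (* the middle coefficient of Phi is never dominant, and Phi expands every radius by a factor of at least q *)
  have \<Phi>_step: "even i \<and> v (coeff \<Phi> i * \<rho> ^ q ^ i) \<ge> q * v \<rho>"
    if \<rho>: "\<rho> \<noteq> 0" and i: "V.dominant q \<Phi> \<rho> i" for \<rho> i
  proof -
    have le: "v (coeff \<Phi> k * \<rho> ^ q ^ k) \<le> v (coeff \<Phi> i * \<rho> ^ q ^ i)" for k
      using V.dominantD(2)[OF i] by (simp add: vle_iff)
    have "i \<noteq> 1"
    proof
      assume "i = 1"
      then have a: "real q * v \<rho> \<le> v \<rho> ^ q" and b: "v y * v \<rho> ^ q ^ 2 \<le> v \<rho> ^ q"
        using le[of 0] le[of 2] by (simp_all add: \<Phi> v_mult v_power v_t)
      have "v \<rho> > 0" using \<rho> by (rule v_pos)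
      show False
      proof (cases "v \<rho> \<le> 1")
        case True
        then have "v \<rho> ^ q \<le> v \<rho> ^ 1" using \<open>v \<rho> > 0\<close> q_gt_1 by (intro power_decreasing) auto
        also have "\<dots> < real q * v \<rho>" using \<open>v \<rho> > 0\<close> q1 by simp
        finally show False using a by simp
      next
        case False
        have "q ^ 1 < q ^ 2" using q_gt_1 by (intro power_strict_increasing) auto
        then have "v \<rho> ^ q < v \<rho> ^ q ^ 2" using False by (intro power_strict_increasing) auto
        also have "\<dots> \<le> v y * v \<rho> ^ q ^ 2" using y \<open>v \<rho> > 0\<close> by (simp add: mult_le_cancel_right1)
        finally show False using b by simp
      qed
    qed
    moreover have "i \<le> 2" using V.dominantD(1)[OF i] \<Phi>(5)[of i] by (meson not_le)
    ultimately have "i = 0 \<or> i = 2" by linarith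
    then show ?thesis using le[of 0] by (auto simp: \<Phi> v_mult v_power v_t)
  qed
  have step: "\<exists>\<rho>'. \<rho>' \<noteq> 0 \<and> v \<rho>' \<ge> q * v \<rho> \<and> (\<exists>k'. even k' \<and> V.dominant q u \<rho>' k')"
    if \<rho>: "\<rho> \<noteq> 0" and k: "V.dominant q u \<rho> k" "even k" for \<rho> k
  proof -
    have "\<Phi> \<noteq> 0" using \<Phi>(2) by auto
    obtain i where i: "V.dominant q \<Phi> \<rho> i" using V.dominant_exists[OF \<open>\<Phi> \<noteq> 0\<close> \<rho>] by blast
    define \<rho>' where "\<rho>' = coeff \<Phi> i * \<rho> ^ q ^ i"
    have \<rho>': "\<rho>' \<noteq> 0" using V.dominantD(1)[OF i] \<rho> by (simp add: \<rho>'_def)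
    obtain k' where k': "V.dominant q u \<rho>' k'" using V.dominant_exists[OF \<open>u \<noteq> 0\<close> \<rho>'] by blast
    define \<sigma> where "\<sigma> = coeff u k * \<rho> ^ q ^ k"
    have \<sigma>: "\<sigma> \<noteq> 0" using V.dominantD(1)[OF k(1)] \<rho> by (simp add: \<sigma>_def)
    obtain i' where i': "V.dominant q \<Phi> \<sigma> i'" using V.dominant_exists[OF \<open>\<Phi> \<noteq> 0\<close> \<sigma>] by blast
    have "u \<odot>\<^sub>\<tau> \<Phi> = \<Phi> \<odot>\<^sub>\<tau> u" using u by (simp add: drinfeld_End_def \<Phi>_def q_eq)
    then have "k' + i = i' + k"
      using V.dominant_mult(1)[OF q_pos i k'[unfolded \<rho>'_def] \<rho>]
        V.dominant_mult(1)[OF q_pos k(1) i'[unfolded \<sigma>_def] \<rho>] V.dominant_unique by metis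
    moreover have "even i" "even i'" using \<Phi>_step[OF \<rho> i] \<Phi>_step[OF \<sigma> i'] by blast+
    ultimately have "even k'" using k(2) by (metis even_add)
    then show ?thesis using \<rho>' k' \<Phi>_step[OF \<rho> i] unfolding \<rho>'_def by blast
  qed
  (* at radii below 1/C the constant term of u dominates, at radii above C its leading term *)
  define C where "C = 1 + (\<Sum>k\<le>degree u. v (coeff u k) / v (coeff u 0) + v (coeff u k) / v (coeff u (degree u)))"
  have ud: "coeff u (degree u) \<noteq> 0" using \<open>u \<noteq> 0\<close> by simp
  have C: "v (coeff u k) < C * v (coeff u 0)" "v (coeff u k) < C * v (coeff u (degree u))" "C \<ge> 1" for k
  proof -
    let ?f = "\<lambda>k. v (coeff u k) / v (coeff u 0) + v (coeff u k) / v (coeff u (degree u))"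
    have nn: "?f k \<ge> 0" for k by (simp add: v_nonneg)
    then have "sum ?f {..degree u} \<ge> 0" by (intro sum_nonneg) auto
    then show "C \<ge> 1" by (simp add: C_def)
    have "?f k < C"
    proof (cases "k \<le> degree u")
      case True
      then have "?f k \<le> sum ?f {..degree u}" using nn by (intro member_le_sum) auto
      then show ?thesis by (simp add: C_def)
    qed (use \<open>C \<ge> 1\<close> in \<open>simp add: coeff_eq_0 v_0\<close>)
    moreover have "v (coeff u k) / v (coeff u 0) \<ge> 0" "v (coeff u k) / v (coeff u (degree u)) \<ge> 0"
      by (simp_all add: v_nonneg)
    ultimately have "v (coeff u k) / v (coeff u 0) < C" "v (coeff u k) / v (coeff u (degree u)) < C"
      by linarith+
    then show "v (coeff u k) < C * v (coeff u 0)" "v (coeff u k) < C * v (coeff u (degree u))"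
      using v_pos[OF u0] v_pos[OF ud] by (simp_all add: divide_less_eq)
  qed
  obtain N where "C < real q ^ N" using real_arch_pow[OF q1] by blast
  define \<rho>\<^sub>0 where "\<rho>\<^sub>0 = 1 / t ^ N"
  have t0: "t \<noteq> 0" using v_t q1 v_0 by auto
  then have \<rho>0: "\<rho>\<^sub>0 \<noteq> 0" by (simp add: \<rho>\<^sub>0_def)
  have v\<rho>: "v \<rho>\<^sub>0 = 1 / real q ^ N" by (simp add: \<rho>\<^sub>0_def v_divide v_1 v_power v_t)
  then have v\<rho>C: "C * v \<rho>\<^sub>0 < 1" using \<open>C < real q ^ N\<close> q1 by simp
  have "V.dominant q u \<rho>\<^sub>0 0"
  proof (rule dominantI[OF u0])
    fix k :: nat assume "k \<noteq> 0"
    define r where "r = v \<rho>\<^sub>0"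
    have r: "r > 0" "C * r < 1" "r \<le> 1"
      using v_pos[OF \<rho>0] v\<rho>C v\<rho> q1 by (auto simp: r_def)
    have "2 \<le> q ^ k" using one_less_power[OF q_gt_1] \<open>k \<noteq> 0\<close> by (metis Suc_leI neq0_conv numeral_2_eq_2 One_nat_def)
    then have "r ^ q ^ k \<le> r ^ 2" using r by (intro power_decreasing) auto
    then have "v (coeff u k) * r ^ q ^ k \<le> v (coeff u k) * r ^ 2" by (intro mult_left_mono v_nonneg)
    also have "\<dots> < (C * v (coeff u 0)) * r ^ 2" using C(1) r(1) by (intro mult_strict_right_mono) auto
    also have "\<dots> = (C * r) * (v (coeff u 0) * r)" by (simp add: power2_eq_square)
    also have "\<dots> \<le> 1 * (v (coeff u 0) * r)" using r v_pos[OF u0] by (intro mult_right_mono) auto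
    finally show "v (coeff u k * \<rho>\<^sub>0 ^ q ^ k) < v (coeff u 0 * \<rho>\<^sub>0 ^ q ^ 0)"
      by (simp add: v_mult v_power r_def)
  qed
  then have orbit: "\<exists>\<rho>. \<rho> \<noteq> 0 \<and> v \<rho> \<ge> q ^ n * v \<rho>\<^sub>0 \<and> (\<exists>k. even k \<and> V.dominant q u \<rho> k)" for n
  proof (induction n)
    case 0
    then show ?case using \<rho>0 by (intro exI[of _ \<rho>\<^sub>0]) auto
  next
    case (Suc n)
    then obtain \<rho> k where \<rho>: "\<rho> \<noteq> 0" "v \<rho> \<ge> q ^ n * v \<rho>\<^sub>0" "even k" "V.dominant q u \<rho> k" by blast
    obtain \<rho>' k' where \<rho>': "\<rho>' \<noteq> 0" "v \<rho>' \<ge> q * v \<rho>" "even k'" "V.dominant q u \<rho>' k'"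
      using step[OF \<rho>(1,4,3)] by blast
    have "q * (q ^ n * v \<rho>\<^sub>0) \<le> q * v \<rho>" using \<rho>(2) by (intro mult_left_mono) auto
    also note \<rho>'(2)
    finally have "v \<rho>' \<ge> q ^ Suc n * v \<rho>\<^sub>0" by (simp add: mult.assoc)
    then show ?case using \<rho>' by blast
  qed
  obtain M where M: "C / v \<rho>\<^sub>0 < real q ^ M" using real_arch_pow[OF q1] by blast
  obtain \<rho> k where \<rho>: "v \<rho> \<ge> q ^ M * v \<rho>\<^sub>0" "even k" "V.dominant q u \<rho> k" using orbit by blast
  have \<rho>C: "v \<rho> > C" using \<rho>(1) M v_pos[OF \<rho>0] by (simp add: divide_less_eq)
  have "V.dominant q u \<rho> (degree u)"
  proof (rule dominantI[OF ud])
    fix k assume k: "k \<noteq> degree u"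
    define r where "r = v \<rho>"
    have r: "r > C" "r > 1" using \<rho>C C(3) by (auto simp: r_def)
    show "v (coeff u k * \<rho> ^ q ^ k) < v (coeff u (degree u) * \<rho> ^ q ^ degree u)"
    proof (cases "k < degree u")
      case True
      have "q ^ k < q ^ degree u" using True q_gt_1 by (intro power_strict_increasing) auto
      then have "r ^ Suc (q ^ k) \<le> r ^ q ^ degree u" using r by (intro power_increasing) auto
      then have le: "r * r ^ q ^ k \<le> r ^ q ^ degree u" by simp
      have "v (coeff u k) * r ^ q ^ k < (C * v (coeff u (degree u))) * r ^ q ^ k"
        using C(2) r by (intro mult_strict_right_mono) auto
      also have "\<dots> \<le> (r * v (coeff u (degree u))) * r ^ q ^ k"
        using r by (intro mult_right_mono) (auto simp: v_nonneg)
      also have "\<dots> \<le> v (coeff u (degree u)) * r ^ q ^ degree u"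
        using mult_left_mono[OF le v_nonneg[of "coeff u (degree u)"]] by (simp add: ac_simps)
      finally show ?thesis by (simp add: v_mult v_power r_def)
    next
      case False
      then have "coeff u k = 0" using k by (simp add: coeff_eq_0)
      moreover have "coeff u (degree u) * \<rho> ^ q ^ degree u \<noteq> 0" using ud r v_0 by (auto simp: r_def)
      ultimately show ?thesis using v_pos by (simp add: v_0)
    qed
  qed
  then have "k = degree u" using \<rho>(3) V.dominant_unique by blast
  then show False using \<rho>(2) odd by simp
qed

lemma v_hom_ge_1: "a \<noteq> 0 \<Longrightarrow> v (\<iota> a) \<ge> 1"
  using v_hom[of a] q_gt_1 by simp

text \<open>
  The powers of an integral element of the fraction field of \<open>A\<close> have a common denominator. If they
  tend to 0, they eventually vanish, because nonzero elements of \<open>A\<close> have absolute value at least 1.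
\<close>

lemma integral_fraction_small_imp_0:
  assumes int: "integral_over (range \<iota>) (\<iota> a / \<iota> b)" and b: "b \<noteq> 0" and small: "v (\<iota> a / \<iota> b) < 1"
  shows "a = 0"
proof (rule ccontr)
  assume a: "a \<noteq> 0"
  interpret A: unital_subring "range \<iota>" by (rule unital_subring_range)
  define c where "c = \<iota> a / \<iota> b"
  have bc: "\<iota> b * c = \<iota> a" using b by (simp add: c_def hom_eq_0_iff)
  have c0: "c \<noteq> 0" using a b by (simp add: c_def hom_eq_0_iff)
  obtain p where p: "lead_coeff p = 1" "\<And>i. coeff p i \<in> range \<iota>" "poly p c = 0"
    using int unfolding integral_over_def c_def by blast
  define n where "n = degree p"
  have "0 = (\<Sum>i\<le>n. coeff p i * c ^ i)" using p(3) by (simp add: poly_altdef n_def)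
  also have "\<dots> = c ^ n + (\<Sum>i<n. coeff p i * c ^ i)"
    using p(1) by (simp add: n_def flip: lessThan_Suc_atMost)
  finally have cn: "c ^ n = - (\<Sum>i<n. coeff p i * c ^ i)" by (simp add: eq_neg_iff_add_eq_0)
  have mem: "\<iota> b ^ n * c ^ N \<in> range \<iota>" for N
  proof (induction N rule: less_induct)
    case (less N)
    show ?case
    proof (cases "N < n")
      case True
      then have "\<iota> b ^ n = \<iota> b ^ (n - N) * \<iota> b ^ N" by (simp flip: power_add)
      then have "\<iota> b ^ n * c ^ N = \<iota> b ^ (n - N) * (\<iota> b * c) ^ N" by (simp add: power_mult_distrib)
      also have "\<dots> = \<iota> (b ^ (n - N) * a ^ N)" unfolding bc by (simp add: hom_mult hom_power)
      finally show ?thesis by simp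
    next
      case False
      then have "c ^ N = c ^ n * c ^ (N - n)" by (simp flip: power_add)
      then have "\<iota> b ^ n * c ^ N = - (\<Sum>i<n. coeff p i * (\<iota> b ^ n * c ^ (i + (N - n))))"
        unfolding cn by (simp add: sum_distrib_left sum_distrib_right power_add ac_simps)
      also have "\<dots> \<in> range \<iota>"
        using False by (intro A.uminus_mem A.sum_mem A.mult_mem p(2) less) auto
      finally show ?thesis .
    qed
  qed
  have "v (\<iota> b ^ n) > 0" using b by (intro v_pos) (simp add: hom_eq_0_iff)
  then obtain N where "v c ^ N < 1 / v (\<iota> b ^ n)"
    using real_arch_pow_inv[of "1 / v (\<iota> b ^ n)" "v c"] small by (auto simp: c_def)
  then have "v (\<iota> b ^ n * c ^ N) < 1"
    using \<open>v (\<iota> b ^ n) > 0\<close> by (simp add: v_mult v_power field_simps)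
  moreover obtain h where h: "\<iota> b ^ n * c ^ N = \<iota> h" using mem by blast
  moreover have "h \<noteq> 0"
  proof
    assume "h = 0"
    then have "\<iota> b ^ n * c ^ N = 0" using h by (simp add: hom_0)
    then show False using b c0 by (simp add: hom_eq_0_iff)
  qed
  ultimately show False using v_hom_ge_1[of h] by simp
qed

text \<open>
  All conjugates of \<open>y = 1/j\<close> have complex multiplication by a square root of \<open>D\<close>, hence absolute value
  less than 1. If \<open>y\<close> were integral, its norm would be a nonzero integral element of the fraction field of
  \<open>A\<close> of absolute value less than 1.
\<close>

theorem inverse_j_not_integral:
  assumes split: "\<And>f :: 'a poly poly. f \<noteq> 0 \<Longrightarrow> \<exists>A. map_poly \<iota> f = smult (\<iota> (lead_coeff f)) (\<Prod>x\<in>#A. [:- x, 1:])"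
    and "odd q" and u: "u \<in> drinfeld_End \<iota> 1 y" and y: "y \<noteq> 0"
    and s: "coeff u 0 ^ 2 = \<iota> D" and odd: "odd (degree D)"
  shows "\<not> integral_over (range \<iota>) y"
proof
  assume int: "integral_over (range \<iota>) y"
  then obtain p :: "'a poly poly" where p: "lead_coeff p = 1" "eval_poly p y = 0"
    unfolding integral_over_range_iff by blast
  have "p \<noteq> 0" using p(1) by auto
  obtain f where f: "f \<noteq> 0" "eval_poly f y = 0" "coeff f 0 \<noteq> 0"
    and conj: "\<And>h z. eval_poly h y = 0 \<Longrightarrow> eval_poly f z = 0 \<Longrightarrow> eval_poly h z = 0"
    using minimal_polynomial[OF \<open>p \<noteq> 0\<close> p(2) y] by blast
  have D0: "D \<noteq> 0" using odd by auto
  have s0: "coeff u 0 \<noteq> 0" using s D0 hom_eq_0_iff[of D] by auto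
  have cm0: "cm_coeff D y n = 0" if "n > degree u" for n
    using coeff_drinfeld_End_eq_cm_coeff[OF \<open>odd q\<close> u s, of n] s0 that by (simp add: coeff_eq_0)
  have conj_small: "v z < 1" if z: "eval_poly f z = 0" for z
  proof -
    have z0: "z \<noteq> 0"
    proof
      assume "z = 0"
      then have "\<iota> (coeff f 0) = 0" using z by (simp add: poly_0_coeff_0 coeff_map_poly hom_0)
      then show False using f(3) by (simp add: hom_eq_0_iff)
    qed
    have "cm_coeff D z n = 0" if "n > degree u" for n
    proof -
      obtain b B where b: "b \<noteq> 0" "\<And>x. \<iota> b * cm_coeff D x n = eval_poly B x"
        using rational_poly_fun_cm_coeff[of D n] unfolding rational_poly_fun_def by blast
      have "eval_poly B y = 0" using cm0[OF that] b(2)[of y] by simp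
      then have "eval_poly B z = 0" by (rule conj[OF _ z])
      then show ?thesis using b(2)[of z] b(1) by (simp add: hom_eq_0_iff)
    qed
    then obtain w where w: "w \<in> drinfeld_End \<iota> 1 z" "coeff w 0 = coeff u 0"
      using drinfeld_End_if_cm_coeff_zero[OF \<open>odd q\<close> s] by blast
    have "degree w = degree D"
      using drinfeld_End_degree[OF w(1) _ z0 D0] w(2) s by simp
    then show ?thesis using abs_inverse_j_less_1[OF w(1)] odd by simp
  qed
  obtain Z where Z: "map_poly \<iota> f = smult (\<iota> (lead_coeff f)) (\<Prod>x\<in>#Z. [:- x, 1:])"
    using split[OF f(1)] by blast
  have lf: "lead_coeff f \<noteq> 0" using f(1) by simp
  have ev: "eval_poly f z = \<iota> (lead_coeff f) * (\<Prod>x\<in>#Z. z - x)" for z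
  proof -
    have "poly (\<Prod>x\<in>#Z. [:- x, 1:]) z = (\<Prod>x\<in>#Z. z - x)"
      by (induction Z) (simp_all add: algebra_simps)
    then show ?thesis unfolding Z by simp
  qed
  have root: "eval_poly f z = 0" if "z \<in># Z" for z
    unfolding ev using that by (auto simp: prod_mset_zero_iff)
  (* up to sign, the norm of y *)
  define c where "c = (\<Prod>x\<in>#Z. - x)"
  have c: "c = \<iota> (coeff f 0) / \<iota> (lead_coeff f)"
  proof -
    have "\<iota> (coeff f 0) = eval_poly f 0" by (simp add: poly_0_coeff_0 coeff_map_poly hom_0)
    then show ?thesis using ev[of 0] lf by (simp add: c_def hom_eq_0_iff)
  qed
  have "integral_over (range \<iota>) c"
    unfolding integral_over_iff[OF unital_subring_range]
  proof (intro allI impI)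
    fix R assume R: "valuation_ring R \<and> range \<iota> \<subseteq> R"
    then interpret valuation_ring R by blast
    have "x \<in> R" if "x \<in># Z" for x
    proof -
      have "eval_poly p x = 0" by (rule conj[OF p(2) root[OF that]])
      then have "integral_over (range \<iota>) x" unfolding integral_over_range_iff using p(1) by blast
      then show ?thesis using R integral_mem by blast
    qed
    then show "c \<in> R" unfolding c_def by (intro prod_mset_mem) (auto intro: uminus_mem)
  qed
  moreover have "v c < 1"
  proof -
    have "Z \<noteq> {#}" using ev[of y] f(2) lf by (auto simp: hom_eq_0_iff)
    have "v (\<Prod>x\<in>#W. - x) \<le> 1" if "\<And>x. x \<in># W \<Longrightarrow> v x < 1" for W
      using that by (induction W) (auto simp: v_1 v_mult v_uminus v_nonneg less_imp_le intro!: mult_le_one)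
    moreover obtain z W where ZW: "Z = add_mset z W" using \<open>Z \<noteq> {#}\<close> by (meson multiset_cases)
    moreover have small: "v x < 1" if "x \<in># Z" for x using conj_small[OF root[OF that]] .
    ultimately have "v (\<Prod>x\<in>#W. - x) \<le> 1" "v z < 1" by auto
    then have "v z * v (\<Prod>x\<in>#W. - x) < 1"
      using mult_left_le[of "v (\<Prod>x\<in>#W. - x)" "v z"] v_nonneg[of z] by linarith
    then show ?thesis by (simp add: c_def ZW v_mult v_uminus)
  qed
  ultimately have "coeff f 0 = 0"
    using integral_fraction_small_imp_0 lf unfolding c by blast
  then show False using f(3) by simp
qed

end

section \<open>Places of even degree\<close>

lemma card_polys_degree_less:
  "card (Poly ` {xs :: 'a :: {field, finite} list. length xs = m}) = CARD('a) ^ m"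
    "\<And>p. p \<in> Poly ` {xs :: 'a list. length xs = m} \<Longrightarrow> p = 0 \<or> degree p < m"
proof -
  have "inj_on Poly {xs :: 'a list. length xs = m}"
  proof (rule inj_onI)
    fix xs ys :: "'a list" assume l: "xs \<in> {xs. length xs = m}" "ys \<in> {xs. length xs = m}" and eq: "Poly xs = Poly ys"
    show "xs = ys"
    proof (rule nth_equalityI)
      fix i assume "i < length xs"
      then show "xs ! i = ys ! i"
        using arg_cong[OF eq, of "\<lambda>p. coeff p i"] l by (simp add: nth_default_def)
    qed (use l in simp)
  qed
  then have "card (Poly ` {xs :: 'a list. length xs = m}) = card {xs :: 'a list. length xs = m}"
    by (rule card_image)
  also have "\<dots> = CARD('a) ^ m" using card_lists_length_eq[of "UNIV :: 'a set" m] by simp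
  finally show "card (Poly ` {xs :: 'a list. length xs = m}) = CARD('a) ^ m" .
  fix p assume "p \<in> Poly ` {xs :: 'a list. length xs = m}"
  then obtain xs where "length xs = m" "p = Poly xs" by blast
  then have "coeff p k = 0" if "k \<ge> m" for k using that by (simp add: nth_default_def)
  then show "p = 0 \<or> degree p < m" by (metis leading_coeff_0_iff not_le)
qed

text \<open>
  A root \<open>\<theta>\<close> of \<open>f\<close> satisfies \<open>\<theta>^(q^n) = \<theta>\<close>. Let \<open>t\<close> be the length of the Frobenius orbit of \<open>\<theta>\<close>, so
  that \<open>t\<close> divides \<open>n\<close>. The orbit consists of roots of \<open>f\<close>, whence \<open>t \<le> deg f\<close>; and the \<open>q^(deg f)\<close>
  elements of the field generated by \<open>\<theta>\<close> are roots of \<open>X^(q^t) - X\<close>, whence \<open>deg f \<le> t\<close>.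
\<close>

theorem degree_dvd_of_prime_dvd_X_power_card:
  fixes f :: "'a :: {field, finite} poly"
  assumes f: "prime_elem f" and dvd: "f dvd monom 1 (CARD('a) ^ n) - monom 1 1" and n: "n > 0"
  shows "degree f dvd n"
proof -
  define q where "q = CARD('a)"
  have q: "q > 1" using card_field_gt_1 by (simp add: q_def)
  have f0: "f \<noteq> 0" and fu: "\<not> is_unit f" using f by (auto simp: prime_elem_def)
  have degf: "degree f > 0" using f0 fu by (meson is_unit_iff_degree neq0_conv)
  define ev where "ev a x = poly (map_poly to_ac a) x" for a :: "'a poly" and x :: "'a alg_closure"
  have ev_pCons: "ev (pCons c a) x = to_ac c + x * ev a x" for c a x
    by (simp add: ev_def map_poly_pCons)
  have ev_0: "ev 0 x = 0" for x by (simp add: ev_def)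
  have ev_add: "ev (a + b) x = ev a x + ev b x" for a b x
    by (induction a b rule: poly_induct2) (simp_all add: ev_pCons ev_0 algebra_simps)
  have ev_smult: "ev (smult c a) x = to_ac c * ev a x" for c a x
    by (induction a) (simp_all add: ev_pCons ev_0 algebra_simps)
  have ev_mult: "ev (a * b) x = ev a x * ev b x" for a b x
    by (induction a) (simp_all add: ev_pCons ev_0 ev_add ev_smult algebra_simps)
  have ev_diff: "ev (a - b) x = ev a x - ev b x" for a b x
    using ev_add[of "a - b" b x] by simp
  have ev_monom: "ev (monom 1 k) x = x ^ k" for k x
    by (simp add: ev_def map_poly_monom poly_monom)
  have Frob: "(x + y :: 'a alg_closure) ^ q ^ k = x ^ q ^ k + y ^ q ^ k" for x y k
  proof (induction k)
    case (Suc k)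
    have "(x + y :: 'a alg_closure) ^ q = x ^ q + y ^ q" for x y
      unfolding q_def by (rule Frobenius_add_field_extension[of to_ac]) (auto simp: inj_to_ac)
    then show ?case using Suc by (simp add: power_mult mult.commute[of q])
  qed simp
  have to_ac_q: "to_ac c ^ q ^ k = to_ac c" for c :: 'a and k
    by (induction k) (simp_all add: power_mult finite_field_power_card q_def flip: to_ac_power)
  have ev_Frob: "ev a x ^ q ^ k = ev a (x ^ q ^ k)" for a x k
    using q by (induction a) (simp_all add: ev_pCons ev_0 Frob to_ac_q power_mult_distrib power_0_left)
  have "degree (map_poly to_ac f) = degree f"
    by (rule map_poly_degree_eq) (simp add: f0)
  then obtain \<theta> where \<theta>: "ev f \<theta> = 0"
    using alg_closed_imp_poly_has_root[of "map_poly to_ac f"] degf by (auto simp: ev_def)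
  (* the minimal polynomial of theta divides f, hence is associated to f *)
  define P where "P a \<longleftrightarrow> a \<noteq> 0 \<and> ev a \<theta> = 0" for a :: "'a poly"
  have "P f" using f0 \<theta> by (simp add: P_def)
  then obtain m where m: "P m" and min: "\<And>a. degree a < degree m \<Longrightarrow> \<not> P a"
    using ex_has_least_nat[of P f degree] by (metis not_le)
  have m_dvd: "m dvd a" if "ev a \<theta> = 0" for a
  proof -
    have "a = m * (a div m) + a mod m" by simp
    then have "ev (a mod m) \<theta> = 0"
      using ev_add[of "m * (a div m)" "a mod m" \<theta>] m that by (simp add: P_def ev_mult)
    moreover have "a mod m = 0 \<or> degree (a mod m) < degree m" using degree_mod_less m P_def by blast
    ultimately have "a mod m = 0" using min unfolding P_def by blast
    then show ?thesis by auto
  qed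
  have f_dvd: "f dvd a" if "ev a \<theta> = 0" for a
  proof -
    obtain h where h: "f = m * h" using m_dvd[OF \<theta>] by blast
    have h0: "h \<noteq> 0" "m \<noteq> 0" using h f0 by auto
    have "f dvd m"
    proof (rule ccontr)
      assume "\<not> f dvd m"
      then have "f dvd h" using prime_elem_dvd_multD[OF f, of m h] h by simp
      then have "degree f \<le> degree h" using h0 by (intro dvd_imp_degree_le)
      then have "degree m = 0" using h h0 by (simp add: degree_mult_eq)
      then obtain c where "m = [:c:]" using degree_eq_zeroE by blast
      then show False using m by (simp add: P_def ev_pCons ev_0)
    qed
    then show ?thesis using m_dvd[OF that] dvd_trans by blast
  qed
  have \<theta>n: "\<theta> ^ q ^ n = \<theta>"
  proof -
    obtain h where "monom 1 (q ^ n) - monom 1 1 = f * h" using dvd by (auto simp: q_def)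
    then have "ev (monom 1 (q ^ n) - monom 1 1) \<theta> = 0" using \<theta> by (simp add: ev_mult)
    then show ?thesis by (simp add: ev_diff ev_monom)
  qed
  define t where "t = (LEAST k. k > 0 \<and> \<theta> ^ q ^ k = \<theta>)"
  have t: "t > 0" "\<theta> ^ q ^ t = \<theta>"
    using LeastI[of "\<lambda>k. k > 0 \<and> \<theta> ^ q ^ k = \<theta>" n] n \<theta>n by (auto simp: t_def)
  have t_min: "\<theta> ^ q ^ k \<noteq> \<theta>" if "0 < k" "k < t" for k
    using not_less_Least[of k "\<lambda>k. k > 0 \<and> \<theta> ^ q ^ k = \<theta>"] that by (auto simp: t_def)
  have split_exp: "\<theta> ^ q ^ (k + l) = (\<theta> ^ q ^ k) ^ q ^ l" for k l
    by (simp add: power_add power_mult)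
  have mult_t: "\<theta> ^ q ^ (t * k) = \<theta>" for k
    by (induction k) (simp_all add: split_exp t(2))
  have "t dvd n"
  proof -
    have "\<theta> ^ q ^ n = \<theta> ^ q ^ (n mod t)"
      using split_exp[of "t * (n div t)" "n mod t"] mult_t by simp
    then have "n mod t = 0" using \<theta>n t_min[of "n mod t"] t(1) by fastforce
    then show ?thesis by auto
  qed
  moreover have "degree f \<le> t"
  proof -
    define S where "S = Poly ` {xs :: 'a list. length xs = degree f}"
    have "inj_on (\<lambda>a. ev a \<theta>) S"
    proof (rule inj_onI)
      fix a b assume ab: "a \<in> S" "b \<in> S" "ev a \<theta> = ev b \<theta>"
      then have "f dvd a - b" by (intro f_dvd) (simp add: ev_diff)
      moreover have "degree (a - b) < degree f"
      proof (rule degree_diff_less)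
        show "degree a < degree f" "degree b < degree f"
          using card_polys_degree_less(2) ab degf unfolding S_def by fastforce+
      qed
      ultimately have "a - b = 0" using dvd_imp_degree_le[of f "a - b"] by force
      then show "a = b" by simp
    qed
    then have card: "card ((\<lambda>a. ev a \<theta>) ` S) = q ^ degree f"
      using card_polys_degree_less(1)[where 'a = 'a, of "degree f"] by (simp add: card_image S_def q_def)
    define B where "B = monom 1 (q ^ t) - monom (1 :: 'a alg_closure) 1"
    have qt: "q ^ t > 1" by (rule one_less_power[OF q t(1)])
    then have "coeff B (q ^ t) = 1" by (simp add: B_def)
    then have B0: "B \<noteq> 0" by auto
    have "degree B \<le> q ^ t" unfolding B_def
      by (rule degree_diff_le) (use qt in \<open>auto simp: degree_monom_eq\<close>)
    have "(\<lambda>a. ev a \<theta>) ` S \<subseteq> {x. poly B x = 0}"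
      by (auto simp: B_def poly_monom ev_Frob t(2))
    then have "q ^ degree f \<le> card {x. poly B x = 0}"
      unfolding card[symmetric] by (rule card_mono[OF poly_roots_finite[OF B0]])
    also have "\<dots> \<le> degree B" by (rule card_poly_roots_bound[OF B0])
    finally have "q ^ degree f \<le> q ^ t" using \<open>degree B \<le> q ^ t\<close> by linarith
    then show ?thesis by (rule power_le_imp_le_exp[OF q])
  qed
  moreover have "t \<le> degree f"
  proof -
    let ?c = "\<lambda>i. \<theta> ^ q ^ i"
    have neq: "?c i \<noteq> ?c j" if "i < j" "j < t" for i j
    proof
      assume "?c i = ?c j"
      then have "?c (i + (t - j)) = ?c (j + (t - j))" unfolding split_exp by simp
      moreover have "j + (t - j) = t" using that by simp
      ultimately have "?c (i + (t - j)) = \<theta>" using t(2) by simp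
      moreover have "0 < i + (t - j)" "i + (t - j) < t" using that by linarith+
      note t_min[OF this]
      ultimately show False by (rule notE[rotated])
    qed
    then have "inj_on ?c {..<t}" by (intro inj_onI) (metis lessThan_iff nat_neq_iff)
    then have "t = card (?c ` {..<t})" by (simp add: card_image)
    also have "\<dots> \<le> card {x. poly (map_poly to_ac f) x = 0}"
    proof (rule card_mono)
      show "finite {x. poly (map_poly to_ac f) x = 0}"
        by (rule poly_roots_finite) (use f0 in \<open>simp add: map_poly_eq_0_iff\<close>)
      show "?c ` {..<t} \<subseteq> {x. poly (map_poly to_ac f) x = 0}"
        using ev_Frob[of f \<theta>] \<theta> q by (auto simp: ev_def power_0_left)
    qed
    also have "\<dots> \<le> degree (map_poly to_ac f)"
      by (rule card_poly_roots_bound) (use f0 in \<open>simp add: map_poly_eq_0_iff\<close>)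
    finally show ?thesis using \<open>degree (map_poly to_ac f) = degree f\<close> by simp
  qed
  ultimately show ?thesis using le_antisym by metis
qed

lemma (in unital_subring) cring_subring:
  "cring (ring_of_type_algebra\<lparr>carrier := S\<rparr>)"
proof -
  have "\<exists>y\<in>S. x + y = 0" if "x \<in> S" for x
    using uminus_mem[OF that] by (intro bexI[of _ "- x"]) auto
  then show ?thesis
    unfolding ring_of_type_algebra_def
    by unfold_locales (auto simp: algebra_simps Units_def one_mem zero_mem intro: add_mem mult_mem)
qed

lemma (in unital_subring) primeideal_subringI:
  assumes "P \<subseteq> S" "0 \<in> P" and add: "\<And>x y. x \<in> P \<Longrightarrow> y \<in> P \<Longrightarrow> x + y \<in> P"
    and mult: "\<And>r x. r \<in> S \<Longrightarrow> x \<in> P \<Longrightarrow> r * x \<in> P"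
    and "1 \<notin> P" and prime: "\<And>x y. x \<in> S \<Longrightarrow> y \<in> S \<Longrightarrow> x * y \<in> P \<Longrightarrow> x \<in> P \<or> y \<in> P"
  shows "primeideal P (ring_of_type_algebra\<lparr>carrier := S\<rparr>)"
proof -
  let ?S = "ring_of_type_algebra\<lparr>carrier := S\<rparr>"
  interpret S: cring ?S by (rule cring_subring)
  have ops: "x \<otimes>\<^bsub>?S\<^esub> y = x * y" "x \<oplus>\<^bsub>?S\<^esub> y = x + y" "\<zero>\<^bsub>?S\<^esub> = 0" "carrier ?S = S"
    "x \<otimes>\<^bsub>ring_of_type_algebra\<^esub> y = x * y" "x \<oplus>\<^bsub>ring_of_type_algebra\<^esub> y = x + y" for x y :: 'c
    by (simp_all add: ring_of_type_algebra_def)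
  have neg: "\<ominus>\<^bsub>?S\<^esub> x = - x" if "x \<in> S" for x
    using S.minus_equality[of "- x" x] uminus_mem[OF that] that by (simp add: ops)
  show ?thesis
  proof (rule primeidealI)
    show "cring ?S" by (rule cring_subring)
    show "ideal P ?S"
    proof (rule idealI)
      show "ring ?S" by (rule S.ring_axioms)
      show "subgroup P (add_monoid ?S)"
      proof (rule subgroup.intro)
        show "P \<subseteq> carrier (add_monoid ?S)" using assms(1) by (simp add: ops)
        show "\<one>\<^bsub>add_monoid ?S\<^esub> \<in> P" using assms(2) by (simp add: ops)
        show "x \<otimes>\<^bsub>add_monoid ?S\<^esub> y \<in> P" if "x \<in> P" "y \<in> P" for x y
          using add[OF that] by (simp add: ops)
        show "inv\<^bsub>add_monoid ?S\<^esub> x \<in> P" if "x \<in> P" for x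
        proof -
          have "- x = (- 1) * x" by simp
          then have "- x \<in> P" using mult[OF uminus_mem[OF one_mem] that] by metis
          then show ?thesis using neg[of x] assms(1) that unfolding a_inv_def by auto
        qed
      qed
      show "x \<otimes>\<^bsub>?S\<^esub> a \<in> P" "a \<otimes>\<^bsub>?S\<^esub> x \<in> P" if "a \<in> P" "x \<in> carrier ?S" for a x
        using mult[of x a] that by (auto simp: ops mult.commute[of a x])
    qed
    show "carrier ?S \<noteq> P" using assms(5) one_mem by (auto simp: ops)
    show "a \<in> P \<or> b \<in> P" if "a \<in> carrier ?S" "b \<in> carrier ?S" "a \<otimes>\<^bsub>?S\<^esub> b \<in> P" for a b
      using prime that by (simp add: ops)
  qed
qed

lemma even_place_generator:
  assumes "p \<in> even_places"
  obtains f :: "'a :: {field, finite} poly" where "prime_elem f" "even (degree f)" "p = {a. f dvd a}"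
proof -
  let ?A = "ring_of_type_algebra :: 'a poly ring"
  have "primeideal p ?A" and p0: "p \<noteq> {0}" and even: "even (place_degree p)"
    using assms by (auto simp: even_places_def finite_place_def)
  interpret primeideal p ?A by fact
  have ops: "x \<otimes>\<^bsub>?A\<^esub> y = x * y" "x \<oplus>\<^bsub>?A\<^esub> y = x + y" "\<zero>\<^bsub>?A\<^esub> = 0" "carrier ?A = UNIV" for x y
    by (simp_all add: ring_of_type_algebra_def)
  have mult: "r * x \<in> p" if "x \<in> p" for r x using I_l_closed[OF that] by (simp add: ops)
  have add: "x + y \<in> p" if "x \<in> p" "y \<in> p" for x y using additive_subgroup.a_closed[OF additive_subgroup_axioms that] by (simp add: ops)
  have diff: "x - y \<in> p" if "x \<in> p" "y \<in> p" for x y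
    using add[OF that(1) mult[OF that(2), of "- 1"]] by simp
  have "0 \<in> p" using additive_subgroup.zero_closed[OF additive_subgroup_axioms] by (simp add: ops)
  then obtain h where h: "h \<in> p" "h \<noteq> 0" using p0 by blast
  define P where "P a \<longleftrightarrow> a \<in> p \<and> a \<noteq> 0" for a
  obtain g where g: "P g" and min: "\<And>a. degree a < degree g \<Longrightarrow> \<not> P a"
    using ex_has_least_nat[of P h degree] h unfolding P_def by (metis not_le)
  define f where "f = smult (inverse (lead_coeff g)) g"
  have lf: "lead_coeff f = 1" and f0: "f \<noteq> 0" using g by (auto simp: f_def P_def)
  have fp: "f \<in> p" using mult[of g "[:inverse (lead_coeff g):]"] g by (simp add: f_def P_def)
  have p_eq: "p = {a. f dvd a}"
  proof (intro equalityI subsetI)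
    fix a assume a: "a \<in> p"
    have "a mod f = a - a div f * f" by (simp add: minus_div_mult_eq_mod)
    then have "a mod f \<in> p" using diff[OF a mult[OF fp]] by metis
    moreover have "a mod f = 0 \<or> degree (a mod f) < degree g"
      using degree_mod_less[OF f0, of a] by (simp add: f_def split: if_splits)
    ultimately have "a mod f = 0" using min unfolding P_def by blast
    then show "a \<in> {a. f dvd a}" by auto
  next
    fix a assume "a \<in> {a. f dvd a}"
    then show "a \<in> p" using mult[OF fp] by (auto simp: mult.commute elim!: dvdE)
  qed
  have PIdl: "PIdl\<^bsub>?A\<^esub> b = {a. b dvd a}" for b
    by (auto simp: cgenideal_def ops dvd_def mult.commute)
  have "(THE f. lead_coeff f = 1 \<and> p = PIdl\<^bsub>?A\<^esub> f) = f"
  proof (rule the_equality)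
    show "lead_coeff f = 1 \<and> p = PIdl\<^bsub>?A\<^esub> f" using lf p_eq PIdl by simp
    fix b assume b: "lead_coeff b = 1 \<and> p = PIdl\<^bsub>?A\<^esub> b"
    then have "{a. b dvd a} = {a. f dvd a}" using p_eq PIdl by simp
    then have "b dvd f" "f dvd b" by (metis dvd_refl mem_Collect_eq)+
    then obtain c k where c: "f = b * c" and k: "b = f * k" unfolding dvd_def by blast
    then have "f * (k * c) = f * 1" by (metis mult.assoc mult_1_right)
    then have "k * c = 1" using f0 by (simp only: mult_cancel_left) simp
    then have "c dvd 1" by (metis dvd_triv_right)
    moreover have "c \<noteq> 0" using c f0 by auto
    ultimately have "degree c = 0" by (simp add: is_unit_iff_degree)
    moreover have "lead_coeff c = 1" using arg_cong[OF c, of lead_coeff] b lf by (simp add: lead_coeff_mult)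
    ultimately have "c = 1" by (metis degree_eq_zeroE coeff_pCons_0 one_pCons)
    then show "b = f" using c by simp
  qed
  then have "even (degree f)" using even by (simp add: place_degree_def)
  moreover have "prime_elem f"
  proof (rule prime_elemI[OF f0])
    show "\<not> f dvd 1"
    proof
      assume "f dvd 1"
      then have "p = UNIV" unfolding p_eq using dvd_trans by (metis UNIV_eq_I mem_Collect_eq one_dvd)
      then show False using I_notcarr by (simp add: ops)
    qed
    show "f dvd a \<or> f dvd b" if "f dvd a * b" for a b
      using I_prime[of a b] that by (simp add: ops p_eq)
  qed
  ultimately show thesis using that p_eq by blast
qed

context infinite_absolute_value
begin

section \<open>Singular moduli whose discriminant has odd degree\<close>

text \<open>
  Since \<open>1/j\<close> is not integral, \<open>j\<close> lies in the maximal ideal of a valuation ring \<open>R\<close> above \<open>A\<close>, and the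
  trace of that ideal on the integral closure of \<open>A\<close> in \<open>k(j)\<close> is a prime dividing \<open>j\<close>. Were the place
  below it of even degree, the differences \<open>T^(q^n) - T\<close> with odd \<open>n\<close> would be units of \<open>R\<close>, and the module,
  rescaled to \<open>\<Delta> = 1\<close>, would reduce to the one with \<open>j = 0\<close> and have no endomorphism of odd degree.
\<close>

lemma not_S_unit_even_places:
  assumes split: "\<And>f :: 'a poly poly. f \<noteq> 0 \<Longrightarrow> \<exists>A. map_poly \<iota> f = smult (\<iota> (lead_coeff f)) (\<Prod>x\<in>#A. [:- x, 1:])"
    and roots: "\<And>x n. integral_over (range \<iota>) x \<Longrightarrow> n > 0 \<Longrightarrow> \<exists>c. c ^ n = x"
    and "odd q" and u: "u \<in> drinfeld_End \<iota> g \<Delta>" and \<Delta>: "\<Delta> \<noteq> 0"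
    and s: "coeff u 0 ^ 2 = \<iota> D" and odd: "odd (degree D)"
  shows "\<not> S_unit \<iota> even_places (j_invariant q g \<Delta>)"
proof
  define j where "j = j_invariant q g \<Delta>"
  assume "S_unit \<iota> even_places (j_invariant q g \<Delta>)"
  then have j0: "j \<noteq> 0"
    and even: "\<And>P. finite_prime \<iota> (k_adjoin \<iota> j) P \<Longrightarrow> j \<in> P \<Longrightarrow> \<iota> -` P \<in> even_places"
    by (auto simp: S_unit_def j_def)
  define y where "y = \<Delta> / g ^ Suc q"
  have g: "g \<noteq> 0" using j0 by (auto simp: j_def j_invariant_def)
  have y0: "y \<noteq> 0" using \<Delta> g by (simp add: y_def)
  have jy: "j = inverse y" by (simp add: j_def j_invariant_def y_def)
  obtain u1 where u1: "u1 \<in> drinfeld_End \<iota> 1 y" "coeff u1 0 = coeff u 0"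
    using drinfeld_End_scale[OF u g] g unfolding y_def by auto
  have s1: "coeff u1 0 ^ 2 = \<iota> D" using s u1(2) by simp
  have D0: "D \<noteq> 0" using odd by auto
  have int: "integral_over (range \<iota>) j"
    unfolding integral_over_iff[OF unital_subring_range]
  proof (intro allI impI)
    fix R assume R: "valuation_ring R \<and> range \<iota> \<subseteq> R"
    then interpret valuation_ring R by blast
    have "vle 1 y" using potential_good_reduction[OF u1(1) s1 odd] R by blast
    then obtain r where "r \<in> R" "1 = r * y" unfolding vle_def by blast
    then have "j = r" unfolding jy by (intro inverse_unique) (simp add: mult.commute)
    then show "j \<in> R" using \<open>r \<in> R\<close> by simp
  qed
  obtain R where R: "valuation_ring R" "range \<iota> \<subseteq> R" "y \<notin> R"
    using exists_valuation_ring_avoiding[OF unital_subring_range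
        inverse_j_not_integral[OF split \<open>odd q\<close> u1(1) y0 s1 odd]] by blast
  interpret valuation_ring R by (rule R(1))
  have j_lt: "vlt j 1"
  proof
    assume "vle 1 j"
    then obtain r where "r \<in> R" "1 = r * j" unfolding vle_def by blast
    then have "y = r" using y0 by (simp add: jy field_simps)
    then show False using R(3) \<open>r \<in> R\<close> by simp
  qed
  define L where "L = k_adjoin \<iota> j"
  define B where "B = integral_closure_in \<iota> L"
  have B: "x \<in> B \<longleftrightarrow> x \<in> L \<and> integral_over (range \<iota>) x" for x
    by (simp add: B_def integral_closure_in_def integral_over_range_iff)
  have \<iota>L: "\<iota> a \<in> L" and jL: "j \<in> L" for a
    unfolding L_def k_adjoin_def by (auto intro: generate_field.incl)
  have L_add: "x + z \<in> L" and L_mult: "x * z \<in> L" if "x \<in> L" "z \<in> L" for x z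
    using generate_field.eng_add[OF that[unfolded L_def k_adjoin_def]]
      generate_field.eng_mult[OF that[unfolded L_def k_adjoin_def]]
    by (simp_all add: L_def k_adjoin_def ring_of_type_algebra_def)
  have L_diff: "x - z \<in> L" if "x \<in> L" "z \<in> L" for x z
    using L_add[OF that(1) L_mult[OF \<iota>L[of "- 1"] that(2)]] by (simp add: hom_uminus hom_1)
  note int_iff = integral_over_iff[OF unital_subring_range]
  interpret B: unital_subring B
  proof
    show "1 \<in> B" unfolding B int_iff using \<iota>L[of 1] hom_1
      by (auto simp: valuation_ring_def unital_subring_def)
    fix x z assume xz: "x \<in> B" "z \<in> B"
    then show "x - z \<in> B" unfolding B int_iff
      using L_diff valuation_ring.axioms(1) unital_subring.diff_mem by metis
    show "x * z \<in> B" using xz unfolding B int_iff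
      using L_mult valuation_ring.axioms(1) unital_subring.mult_mem by metis
  qed
  have BR: "x \<in> R" if "x \<in> B" for x using that R unfolding B int_iff by blast
  define P where "P = {x \<in> B. vlt x 1}"
  have small: "vlt (r * x) 1" if "vlt x 1" "r \<in> R" for x r
    using vlt_mult[OF that(1), of r 1] that(2) by (simp add: vle_1_iff mult.commute)
  have "primeideal P (ring_of_type_algebra\<lparr>carrier := B\<rparr>)"
  proof (rule B.primeideal_subringI)
    show "P \<subseteq> B" "0 \<in> P" "1 \<notin> P" by (auto simp: P_def B.zero_mem)
    show "x + z \<in> P" if "x \<in> P" "z \<in> P" for x z
      using that B.add_mem vlt_add unfolding P_def by blast
    show "r * x \<in> P" if "r \<in> B" "x \<in> P" for r x
      using that B.mult_mem small BR unfolding P_def by blast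
    show "x \<in> P \<or> z \<in> P" if "x \<in> B" "z \<in> B" "x * z \<in> P" for x z
    proof (rule ccontr)
      assume "\<not> (x \<in> P \<or> z \<in> P)"
      then have "vle 1 x" "vle 1 z" using that by (auto simp: P_def)
      then have "vle (1 * 1) (x * z)" by (rule vle_mult)
      then show False using that(3) by (simp add: P_def)
    qed
  qed
  moreover have jP: "j \<in> P" using jL int j_lt by (simp add: P_def B)
  ultimately have "finite_prime \<iota> L P" using j0 by (auto simp: finite_prime_def B_def)
  then have "\<iota> -` P \<in> even_places" using even jP by (simp add: L_def)
  then obtain f where f: "prime_elem f" "even (degree f)" "\<iota> -` P = {a. f dvd a}"
    by (rule even_place_generator)
  have \<iota>B: "\<iota> a \<in> B" for a
    unfolding B int_iff using \<iota>L by blast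
  have unit: "vle 1 (t ^ q ^ n - t)" if "odd n" for n
  proof (rule ccontr)
    define a where "a = monom 1 (q ^ n) - monom (1 :: 'a) 1"
    have "\<iota> a = t ^ q ^ n - t"
      by (simp add: a_def t_def monom_altdef hom_diff hom_power)
    moreover assume "vlt (t ^ q ^ n - t) 1"
    ultimately have "\<iota> a \<in> P" using \<iota>B[of a] by (simp add: P_def)
    then have "f dvd a" using f(3) by blast
    then have "degree f dvd n"
      using degree_dvd_of_prime_dvd_X_power_card[OF f(1), of n] that
      by (auto simp: a_def q_eq intro: odd_pos)
    then show False using f(2) that dvd_trans by blast
  qed
  have "(q - 1) * Suc q > 0" using q_gt_1 by simp
  (* the exponent is q^2 - 1; conjugation by c turns Delta = y into 1 and g = 1 into c^(q-1) *)
  then obtain c where c: "c ^ ((q - 1) * Suc q) = j" using roots[OF int] by blast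
  have c0: "c \<noteq> 0" using c j0 \<open>(q - 1) * Suc q > 0\<close> by (metis zero_power)
  define \<gamma> where "\<gamma> = inverse (c ^ (q - 1))"
  have \<gamma>: "\<gamma> \<noteq> 0" using c0 by (simp add: \<gamma>_def)
  have "y / \<gamma> ^ Suc q = y * j"
    unfolding \<gamma>_def using c by (simp only: power_mult power_inverse divide_inverse inverse_inverse_eq)
  then have one: "y / \<gamma> ^ Suc q = 1" using y0 by (simp add: jy)
  obtain u2 where u2: "u2 \<in> drinfeld_End \<iota> (1 / \<gamma>) 1" "degree u2 = degree u1"
    using drinfeld_End_scale[OF u1(1) \<gamma>] unfolding one by blast
  have deg: "degree u1 = degree D" by (rule drinfeld_End_degree[OF u1(1) s1 y0 D0])
  have "vlt c 1"
  proof
    assume "vle 1 c"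
    then have "vle (1 ^ ((q - 1) * Suc q)) (c ^ ((q - 1) * Suc q))" by (rule vle_power)
    then show False using j_lt c by simp
  qed
  then have "vlt (c ^ (q - 1)) (1 ^ (q - 1))" by (rule vlt_power) (use q_gt_1 in simp)
  then have "vlt (1 / \<gamma>) 1" by (simp add: \<gamma>_def inverse_eq_divide)
  moreover have "u2 \<noteq> 0" using u2(2) deg odd by auto
  ultimately have "even (degree u2)"
    using even_degree_of_reduction_to_j_0[OF u2(1) _ R(1,2)] unit by blast
  then show False using u2(2) deg odd by simp
qed

end

context completed_alg_closure
begin

lemma e_0: "e 0 = 0"
proof -
  have "e 0 + e 0 = e 0 + 0" using e_add[of 0 0] by simp
  then show ?thesis by (rule add_left_imp_eq)
qed

lemma e_uminus: "e (- x) = - e x"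
  using e_add[of x "- x"] by (simp add: e_0 eq_neg_iff_add_eq_0 add.commute)

lemma e_diff: "e (x - y) = e x - e y"
  using e_add[of x "- y"] by (simp add: e_uminus)

lemma e_power: "e (x ^ n) = e x ^ n"
  by (induction n) (simp_all add: e_one e_mult)

lemma e_eq_0_iff: "e x = 0 \<longleftrightarrow> x = 0"
proof
  assume *: "e x = 0"
  show "x = 0"
  proof (rule ccontr)
    assume "x \<noteq> 0"
    then have "e (x * inverse x) = 1" by (simp add: e_one)
    then show False using * by (simp add: e_mult)
  qed
qed (simp add: e_0)

definition A_embed_fls :: "'a poly \<Rightarrow> 'a fls" where
  "A_embed_fls a = poly (map_poly fls_const a) fls_X_inv"

lemma A_embed_eq: "A_embed e a = e (to_ac (A_embed_fls a))"
  by (simp add: A_embed_def A_embed_fls_def)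

lemma A_embed_fls_pCons: "A_embed_fls (pCons c a) = fls_const c + fls_X_inv * A_embed_fls a"
  by (simp add: A_embed_fls_def map_poly_pCons)

lemma A_embed_fls_0: "A_embed_fls 0 = 0"
  by (simp add: A_embed_fls_def)

lemma A_embed_fls_add: "A_embed_fls (a + b) = A_embed_fls a + A_embed_fls b"
  by (induction a b rule: poly_induct2)
    (simp_all add: A_embed_fls_0 A_embed_fls_pCons algebra_simps flip: fls_plus_const)

lemma A_embed_fls_smult: "A_embed_fls (smult c a) = fls_const c * A_embed_fls a"
  by (induction a) (simp_all add: A_embed_fls_0 A_embed_fls_pCons algebra_simps)

lemma A_embed_fls_mult: "A_embed_fls (a * b) = A_embed_fls a * A_embed_fls b"
  by (induction a)
    (simp_all add: A_embed_fls_0 A_embed_fls_pCons A_embed_fls_add A_embed_fls_smult algebra_simps)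

lemma A_embed_fls_subdegree:
  "a \<noteq> 0 \<Longrightarrow> A_embed_fls a \<noteq> 0 \<and> fls_subdegree (A_embed_fls a) = - int (degree a)"
proof (induction a)
  case (pCons c a)
  show ?case
  proof (cases "a = 0")
    case True
    then show ?thesis using pCons.hyps by (simp add: A_embed_fls_pCons A_embed_fls_0)
  next
    case False
    define x where "x = fls_X_inv * A_embed_fls a"
    have x: "x \<noteq> 0" "fls_subdegree x = - int (Suc (degree a))"
      using pCons.IH[OF False] by (simp_all add: x_def)
    have "fls_subdegree (fls_const c + x) = fls_subdegree x"
      by (rule fls_subdegree_add_eq2) (use x in auto)
    moreover have "fls_const c + x \<noteq> 0"
      using calculation x by auto
    ultimately show ?thesis using x False by (simp add: A_embed_fls_pCons flip: x_def)
  qed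
qed simp

lemma infinite_absolute_value_A_embed:
  "infinite_absolute_value (A_embed e) CARD('a) v"
proof
  show "A_embed e 1 = 1"
    using A_embed_fls_pCons[of 1 0] by (simp add: A_embed_eq A_embed_fls_0 e_one flip: one_pCons)
  show "A_embed e (a + b) = A_embed e a + A_embed e b" for a b
    by (simp add: A_embed_eq A_embed_fls_add e_add)
  show "A_embed e (a * b) = A_embed e a * A_embed e b" for a b
    by (simp add: A_embed_eq A_embed_fls_mult e_mult)
  show "A_embed e a = 0 \<longleftrightarrow> a = 0" for a
    using A_embed_fls_subdegree[of a] by (auto simp: A_embed_eq A_embed_fls_0 e_eq_0_iff)
  show "v (A_embed e a) = real CARD('a) ^ degree a" if "a \<noteq> 0" for a
    using A_embed_fls_subdegree[OF that] v_extends[of "A_embed_fls a"]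
    by (simp add: A_embed_eq)
qed (auto simp: v_nonneg v_eq_0_iff v_mult v_ultrametric)

lemma A_embed_poly_splits:
  assumes "f \<noteq> 0"
  shows "\<exists>A. map_poly (A_embed e) f = smult (A_embed e (lead_coeff f)) (\<Prod>x\<in>#A. [:- e x, 1:])"
proof -
  define \<kappa> where "\<kappa> a = to_ac (A_embed_fls a)" for a
  have \<kappa>0: "\<kappa> a = 0 \<longleftrightarrow> a = 0" for a
    using A_embed_fls_subdegree[of a] by (auto simp: \<kappa>_def A_embed_fls_0)
  have deg: "degree (map_poly \<kappa> f) = degree f"
    by (rule map_poly_degree_eq) (use assms in \<open>simp add: \<kappa>0\<close>)
  have "map_poly \<kappa> f \<noteq> 0" using assms by (simp add: map_poly_eq_0_iff \<kappa>0)
  then obtain A where A: "map_poly \<kappa> f = smult (lead_coeff (map_poly \<kappa> f)) (\<Prod>x\<in>#A. [:- x, 1:])"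
    using alg_closed_imp_factorization by blast
  have lc: "lead_coeff (map_poly \<kappa> f) = \<kappa> (lead_coeff f)"
    by (simp add: deg coeff_map_poly \<kappa>0)
  have e_smult: "map_poly e (smult c p) = smult (e c) (map_poly e p)" for c p
    by (rule poly_eqI) (simp add: coeff_map_poly e_0 e_mult)
  have e_linear: "map_poly e ([:- x, 1:] * p) = [:- e x, 1:] * map_poly e p" for x p
    by (rule poly_eqI)
      (simp add: coeff_map_poly e_0 e_mult e_diff e_uminus coeff_pCons split: nat.split)
  have prod: "map_poly e (\<Prod>x\<in>#A. [:- x, 1:]) = (\<Prod>x\<in>#A. [:- e x, 1:])" for A
    by (induction A) (simp_all add: e_linear e_one del: mult_pCons_left)
  have "map_poly (A_embed e) f = map_poly e (map_poly \<kappa> f)"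
    by (rule poly_eqI) (simp add: coeff_map_poly \<kappa>0 e_0 A_embed_eq A_embed_fls_0 \<kappa>_def)
  also have "\<dots> = smult (A_embed e (lead_coeff f)) (\<Prod>x\<in>#A. [:- e x, 1:])"
    by (subst A) (simp only: e_smult prod lc, simp add: A_embed_eq \<kappa>_def)
  finally show ?thesis by blast
qed

text \<open>
  An integral element is algebraic over the fraction field of \<open>A\<close>, so it already lies in the image of the
  algebraic closure.
\<close>

lemma integral_root_exists:
  assumes "integral_over (range (A_embed e)) x" and "n > 0"
  shows "\<exists>c. c ^ n = x"
proof -
  interpret infinite_absolute_value "A_embed e" "CARD('a)" v
    by (rule infinite_absolute_value_A_embed)
  obtain p :: "'a poly poly" where p: "lead_coeff p = 1" "eval_poly p x = 0"
    using assms(1) unfolding integral_over_range_iff by blast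
  then have "p \<noteq> 0" by auto
  then obtain A where "map_poly (A_embed e) p = smult (A_embed e (lead_coeff p)) (\<Prod>z\<in>#A. [:- e z, 1:])"
    using A_embed_poly_splits by blast
  then have "poly (\<Prod>z\<in>#A. [:- e z, 1:]) x = 0" using p by (simp add: hom_1)
  moreover have "poly (\<Prod>z\<in>#A. [:- e z, 1:]) x = 0 \<longleftrightarrow> (\<exists>z. z \<in># A \<and> x = e z)" for A
    by (induction A) auto
  ultimately obtain z where "x = e z" by blast
  moreover obtain w where "w ^ n = z" using nth_root_exists[OF assms(2)] by blast
  ultimately have "e w ^ n = x" by (simp flip: e_power)
  then show ?thesis by blast
qed

end

theorem proposition2:
  fixes e :: "'a :: {field, finite} fls alg_closure \<Rightarrow> 'c :: field"
    and v :: "'c \<Rightarrow> real"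
  assumes "completed_alg_closure e v"
    and "CARD('a) mod 4 = 1"
  shows "\<not> (\<exists>(D :: 'a poly) R j.
            irreducible D \<and> odd (degree D) \<and>
            order_of_discriminant (A_embed e) D R \<and>
            singular_modulus_of_order (A_embed e) R j \<and>
            S_unit (A_embed e) even_places j)"
proof (intro notI, elim exE conjE)
  fix D :: "'a poly" and R j
  assume odd: "odd (degree D)" and ord: "order_of_discriminant (A_embed e) D R"
    and sing: "singular_modulus_of_order (A_embed e) R j" and unit: "S_unit (A_embed e) even_places j"
  interpret C: completed_alg_closure e v by fact
  interpret infinite_absolute_value "A_embed e" "CARD('a)" v
    by (rule C.infinite_absolute_value_A_embed)
  obtain s where s: "s ^ 2 = A_embed e D" "R = {A_embed e a + A_embed e b * s | a b. True}"
    using ord unfolding order_of_discriminant_def by blast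
  have "s = A_embed e 0 + A_embed e 1 * s" by (simp add: hom_0 hom_1)
  then have "s \<in> R" unfolding s(2) by blast
  moreover obtain g \<Delta> where g: "\<Delta> \<noteq> 0" "End_ring (A_embed e) g \<Delta> = R" "j_invariant CARD('a) g \<Delta> = j"
    using sing unfolding singular_modulus_of_order_def by blast
  ultimately obtain u where u: "u \<in> drinfeld_End (A_embed e) g \<Delta>" "coeff u 0 = s"
    unfolding End_ring_def by blast
  have "odd CARD('a)" using assms(2) by presburger
  have split: "\<exists>A. map_poly (A_embed e) f = smult (A_embed e (lead_coeff f)) (\<Prod>x\<in>#A. [:- x, 1:])"
    if "f \<noteq> 0" for f
  proof -
    obtain A where "map_poly (A_embed e) f = smult (A_embed e (lead_coeff f)) (\<Prod>x\<in>#A. [:- e x, 1:])"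
      using C.A_embed_poly_splits[OF \<open>f \<noteq> 0\<close>] by blast
    then show ?thesis by (intro exI[of _ "image_mset e A"]) (simp add: image_mset.compositionality comp_def)
  qed
  show False
    using not_S_unit_even_places[OF split C.integral_root_exists \<open>odd CARD('a)\<close> u(1) g(1) _ odd] u(2) s(1) unit g(3)
    by simp
qed

end
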